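(* Let $\mathcal{E}$ be a non-empty compact subset of $[0,2\pi)$ (with the endpoints of $[0,2\pi)$ identified), and let $\rho\in[0,\infty]$. Then there exist a transcendental entire function $f$ of infinite lower order, and a transcendental meromorphic function $g$ of order $\rho$, such that $$L(f)=L(g)=\mathcal{E}.$$
   Context: Functions are considered in $\mathbb{C}$; "meromorphic function" here means meromorphic in $\mathbb{C}$ with at least one pole. For a transcendental entire or meromorphic $f$, the Fatou set $\mathcal{F}(f)$ is the set of points having a neighborhood in which all iterates $f^n$ ($n\ge 1$) are well defined and form a normal family; the Julia set $\mathcal{J}(f)$ is its complement. A value $\theta\in[0,2\pi)$ is a Julia limiting direction of $f$ if there is an unbounded sequence $\{z_n\}\subset\mathcal{J}(f)$ with $\lim_{n\to\infty}\arg z_n=\theta$. $L(f)$ denotes the set of all Julia limiting directions of $f$. Throughout, the two endpoints of $[0,2\pi)$ are identified, so that $[0,2\pi)$ is a compact set (a circle), and arguments are taken modulo $2\pi$. With $T(r,f)$ the Nevanlinna characteristic and $\log^+x=\max\{\log x,0\}$, the order and lower order are $$\rho(f)=\limsup_{r\to\infty}\frac{\log^+T(r,f)}{\log r},\qquad \mu(f)=\liminf_{r\to\infty}\frac{\log^+T(r,f)}{\log r}.$$ *)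

theory Defs
  imports "HOL-Complex_Analysis.Complex_Analysis"
begin

definition transcendental_entire :: "(complex \<Rightarrow> complex) \<Rightarrow> bool" where
  "transcendental_entire f \<longleftrightarrow> f holomorphic_on UNIV \<and> \<not> (\<exists>p. \<forall>z. f z = poly p z)"

text \<open>The predicate \<^const>\<open>nicely_meromorphic_on\<close> selects the representative that is analytic
  off its poles (and is 0, as a dummy value, at each pole). Meromorphic functions are
  required to have at least one pole.\<close>

definition transcendental_meromorphic :: "(complex \<Rightarrow> complex) \<Rightarrow> bool" where
  "transcendental_meromorphic f \<longleftrightarrow>
     f nicely_meromorphic_on UNIV \<and> (\<exists>z. is_pole f z) \<and>
     \<not> (\<exists>p q. q \<noteq> 0 \<and> (\<forall>z. poly q z \<noteq> 0 \<longrightarrow> f z = poly p z / poly q z))"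

subsection \<open>Nevanlinna characteristic, order and lower order\<close>

text \<open>In HOL \<open>ln 0 = 0\<close>, so \<open>log_plus 0 = 0\<close>, which agrees with the usual convention.\<close>

definition log_plus :: "real \<Rightarrow> real" where
  "log_plus x = max (ln x) 0"

definition proximity_fun :: "real \<Rightarrow> (complex \<Rightarrow> complex) \<Rightarrow> real" where
  "proximity_fun r f =
     integral {0..2*pi} (\<lambda>\<theta>. log_plus (norm (f (of_real r * cis \<theta>)))) / (2*pi)"

text \<open>Number of poles in the closed disc of radius \<open>t\<close>, counted with multiplicity.\<close>

definition pole_count :: "real \<Rightarrow> (complex \<Rightarrow> complex) \<Rightarrow> nat" where
  "pole_count t f = (\<Sum>z\<in>{z. norm z \<le> t \<and> is_pole f z}. nat (- zorder f z))"

definition integrated_pole_count :: "real \<Rightarrow> (complex \<Rightarrow> complex) \<Rightarrow> real" where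
  "integrated_pole_count r f =
     integral {0..r} (\<lambda>t. (real (pole_count t f) - real (pole_count 0 f)) / t)
       + real (pole_count 0 f) * ln r"

definition nevanlinna_char :: "real \<Rightarrow> (complex \<Rightarrow> complex) \<Rightarrow> real" where
  "nevanlinna_char r f = proximity_fun r f + integrated_pole_count r f"

definition growth_order :: "(complex \<Rightarrow> complex) \<Rightarrow> ereal" where
  "growth_order f = Limsup at_top (\<lambda>r. ereal (log_plus (nevanlinna_char r f) / ln r))"

definition lower_growth_order :: "(complex \<Rightarrow> complex) \<Rightarrow> ereal" where
  "lower_growth_order f = Liminf at_top (\<lambda>r. ereal (log_plus (nevanlinna_char r f) / ln r))"

subsection \<open>Fatou and Julia sets\<close>

text \<open>Inverse stereographic projection of the plane into the unit sphere (the point at infinity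
  corresponds to \<open>(0, 1)\<close>); the Euclidean distance of the images is the chordal
  distance. Normality is with respect to this distance, so that locally uniform convergence to
  infinity is allowed.\<close>

definition to_sphere :: "complex \<Rightarrow> complex \<times> real" where
  "to_sphere z = (2 * z / of_real (1 + (norm z)\<^sup>2), ((norm z)\<^sup>2 - 1) / ((norm z)\<^sup>2 + 1))"

definition normal_family_on :: "complex set \<Rightarrow> (complex \<Rightarrow> complex) set \<Rightarrow> bool" where
  "normal_family_on U F \<longleftrightarrow>
     (\<forall>h :: nat \<Rightarrow> complex \<Rightarrow> complex. (\<forall>n. h n \<in> F) \<longrightarrow>
        (\<exists>r g. strict_mono r \<and>
           (\<forall>K. compact K \<and> K \<subseteq> U \<longrightarrow>
              uniform_limit K (\<lambda>n z. to_sphere (h (r n) z)) g sequentially)))"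

text \<open>All iterates are well defined at \<open>w\<close> iff the orbit of \<open>w\<close> contains no pole: if
  \<open>f\<close> has a pole at the \<open>n\<close>-th iterate, then iterate \<open>n + 2\<close> would
  require the value of \<open>f\<close> at infinity. Where all iterates are well defined they are
  finite, and they agree with the iterates of \<open>f\<close> as a total function.\<close>

definition Fatou_set :: "(complex \<Rightarrow> complex) \<Rightarrow> complex set" where
  "Fatou_set f = {z. \<exists>U. open U \<and> z \<in> U \<and>
     (\<forall>w\<in>U. \<forall>n. \<not> is_pole f ((f ^^ n) w)) \<and>
     normal_family_on U {f ^^ n | n. n \<ge> 1}}"

definition Julia_set :: "(complex \<Rightarrow> complex) \<Rightarrow> complex set" where
  "Julia_set f = - Fatou_set f"

text \<open>The interval \<open>[0, 2\<pi>)\<close> with endpoints identified is the circle, via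
  \<^const>\<open>cis\<close>; convergence of arguments is convergence on that circle.\<close>

definition Julia_limiting_direction :: "(complex \<Rightarrow> complex) \<Rightarrow> real \<Rightarrow> bool" where
  "Julia_limiting_direction f \<theta> \<longleftrightarrow>
     (\<exists>z :: nat \<Rightarrow> complex. (\<forall>n. z n \<in> Julia_set f \<and> z n \<noteq> 0) \<and> \<not> bounded (range z) \<and>
        (\<lambda>n. cis (Arg2pi (z n))) \<longlonglongrightarrow> cis \<theta>)"

definition Julia_limiting_directions :: "(complex \<Rightarrow> complex) \<Rightarrow> real set" where
  "Julia_limiting_directions f = {\<theta> \<in> {0..<2*pi}. Julia_limiting_direction f \<theta>}"

end

theory Submission
  imports Defs "HOL-Real_Asymp.Real_Asymp"
begin

text \<open>
Both functions come from one principle. If a function is bounded by \<open>1\<close> on a set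
\<open>X\<close> that contains the closed unit disc, then \<open>X\<close> is mapped into itself
and all iterates are bounded there, so by Montel's theorem the Julia set stays within distance
\<open>1\<close> of the complement of \<open>X\<close> (\<open>trapped_in_Fatou_set\<close>). It
therefore suffices to build functions that are large only in thin regions running to infinity in
the prescribed directions, and to find Julia points far out in these regions. Choose unimodular
numbers \<open>u k = cis \<theta>\<close> with \<open>\<theta> \<in> E\<close> that come
arbitrarily close to every point of \<open>cis ` E\<close> infinitely often.

The meromorphic function is \<open>(\<Sum>k. (\<epsilon> k / (z - p k)) ^ m k)\<close> with poles
\<open>p k = 2 ^ (k + 2) * u k\<close>, where \<open>\<epsilon> k = (1/2) ^ Suc k\<close>, bounded
by \<open>1\<close> off the unit discs about the poles. Poles belong to the Julia set, so
\<open>E\<close> is the set of limiting directions whatever the multiplicities \<open>m k\<close>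
are. These can therefore be used to prescribe the order: the characteristic is the counting
function \<open>(\<Sum>k. m k * ln (r / 2 ^ (k + 2)))\<close> up to an error controlled by a
single \<open>m k\<close>, and \<open>m k\<close> is chosen close to \<open>\<bar>p k\<bar> powr
\<rho>\<close> (\<open>growth_order_pole_sum_ge\<close>, \<open>growth_order_pole_sum_le\<close>).

The entire function is a sum of rotated and translated copies of one entire function that is
bounded off the half strip \<open>Re z > -1\<close>, \<open>\<bar>Im z\<bar> < pi + 1\<close> and
differs from \<open>exp (exp z)\<close> by a bounded amount in its middle. It is the analytic
continuation of the Cauchy integral of \<open>exp (exp t)\<close> over the boundary of a half
strip; the integral converges because \<open>exp (exp t)\<close> decays doubly exponentially on
the lines \<open>Im t = \<plusminus>pi\<close> (\<open>strip_function_bound_outside\<close>,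
\<open>strip_function_inside\<close>). Far out in each strip the sum behaves like \<open>c * exp
(exp w)\<close>. This produces repelling fixed points, which lie in the Julia set
(\<open>repelling_fixed_points_in_strip\<close>,
\<open>repelling_fixed_point_in_Julia_set\<close>), and it makes the proximity function at least
\<open>exp (r - const) / r\<close> up to a constant factor, so that the lower order is infinite.
\<close>

section \<open>An entire function that is large only in a half strip\<close>

text \<open>
  Weierstrass M-test in the form needed for all series below: on a bounded part of \<open>S\<close>
  only finitely many terms may violate the bound, since far-away strips and poles do not see that
  part.
\<close>

lemma holomorphic_on_suminf:
  fixes h :: "nat \<Rightarrow> complex \<Rightarrow> complex"
  assumes "open S" and hol: "\<And>k. h k holomorphic_on S" and M: "summable M"
    and bd: "\<And>R. \<exists>N. \<forall>k\<ge>N. \<forall>z\<in>S. norm z \<le> R \<longrightarrow> norm (h k z) \<le> M k"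
  shows "(\<lambda>z. \<Sum>k. h k z) holomorphic_on S"
proof (rule holomorphic_uniform_sequence[OF \<open>open S\<close>])
  show "(\<lambda>z. \<Sum>k<n. h k z) holomorphic_on S" for n
    by (intro holomorphic_intros hol)
  fix x assume "x \<in> S"
  then obtain d where d: "d > 0" "cball x d \<subseteq> S"
    using \<open>open S\<close> open_contains_cball by blast
  obtain N where N: "\<forall>k\<ge>N. \<forall>z\<in>S. norm z \<le> norm x + d \<longrightarrow> norm (h k z) \<le> M k"
    using bd by blast
  have "norm z \<le> norm x + d" if "z \<in> cball x d" for z
    using that norm_triangle_sub[of z x] by (auto simp: dist_norm norm_minus_commute)
  then have "\<forall>\<^sub>F k in sequentially. \<forall>z\<in>cball x d. norm (h k z) \<le> M k"
    unfolding eventually_sequentially using N d by blast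
  then have "uniform_limit (cball x d) (\<lambda>n z. \<Sum>k<n. h k z) (\<lambda>z. \<Sum>k. h k z) sequentially"
    by (rule Weierstrass_m_test_ev[OF _ M])
  with d show "\<exists>d>0. cball x d \<subseteq> S \<and>
      uniform_limit (cball x d) (\<lambda>n z. \<Sum>k<n. h k z) (\<lambda>z. \<Sum>k. h k z) sequentially"
    by blast
qed

text \<open>
  The Cauchy transform of \<open>exp (exp t)\<close> over a segment, without the factor \<open>1 /
  (2 * pi * \<i>)\<close>. Cutting the boundary of the half strip into segments turns its improper
  integral into a series.
\<close>

definition segment_transform :: "complex \<Rightarrow> complex \<Rightarrow> complex \<Rightarrow> complex" where
  "segment_transform a b z = contour_integral (linepath a b) (\<lambda>t. exp (exp t) / (t - z))"

lemma segment_kernel_continuous: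
  "z \<notin> S \<Longrightarrow> continuous_on S (\<lambda>t. exp (exp t) / (t - z))" for z :: complex
  by (intro continuous_intros) auto

lemma segment_transform_holomorphic:
  "segment_transform a b holomorphic_on - closed_segment a b"
proof -
  have "(segment_transform a b has_field_derivative
      (1::nat) * contour_integral (linepath a b) (\<lambda>t. exp (exp t) / (t - w) ^ Suc 1)) (at w)"
    if w: "w \<in> - closed_segment a b" for w
  proof (rule Cauchy_next_derivative(2)[where S = UNIV and B = "norm (b - a)"])
    show "((\<lambda>t. exp (exp t) / (t - v) ^ 1) has_contour_integral segment_transform a b v) (linepath a b)"
      if "v \<in> UNIV - path_image (linepath a b)" for v
      unfolding segment_transform_def using that
      by (auto intro!: has_contour_integral_integral contour_integrable_continuous_linepath
          segment_kernel_continuous)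
  qed (use w in \<open>auto intro!: continuous_intros\<close>)
  then show ?thesis
    by (auto simp: holomorphic_on_open open_Compl)
qed

text \<open>
  Distance at least \<open>1\<close> from the segment makes the Cauchy kernel at most
  \<open>1\<close>.
\<close>

lemma segment_transform_bound:
  assumes "z \<notin> closed_segment a b" "B \<ge> 0"
    and "\<And>t. t \<in> closed_segment a b \<Longrightarrow> norm (exp (exp t)) \<le> B"
    and "\<And>t. t \<in> closed_segment a b \<Longrightarrow> norm (t - z) \<ge> 1"
  shows "norm (segment_transform a b z) \<le> B * norm (b - a)"
  unfolding segment_transform_def
proof (rule contour_integral_bound_linepath)
  show "(\<lambda>t. exp (exp t) / (t - z)) contour_integrable_on linepath a b"
    using assms(1) by (intro contour_integrable_continuous_linepath segment_kernel_continuous)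
  show "norm (exp (exp t) / (t - z)) \<le> B" if "t \<in> closed_segment a b" for t
  proof -
    have "norm (exp (exp t)) / norm (t - z) \<le> norm (exp (exp t)) / 1"
      by (intro divide_left_mono) (use assms(4)[OF that] in \<open>auto simp: field_simps\<close>)
    then show ?thesis using assms(3)[OF that] by (simp add: norm_divide)
  qed
qed fact

text \<open>
  The left edge, traversed downwards, and a piece of the two horizontal sides, traversed with the
  half strip on the left: the parts of a positively oriented boundary.
\<close>

definition edge_transform :: "real \<Rightarrow> complex \<Rightarrow> complex" where
  "edge_transform s = segment_transform (Complex s pi) (Complex s (-pi))"

definition sides_transform :: "real \<Rightarrow> real \<Rightarrow> complex \<Rightarrow> complex" where
  "sides_transform a b z = segment_transform (Complex a (-pi)) (Complex b (-pi)) z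
     + segment_transform (Complex b pi) (Complex a pi) z"

lemma closed_segment_vertical:
  "a \<le> b \<Longrightarrow> closed_segment (Complex s a) (Complex s b) = {z. Re z = s \<and> Im z \<in> {a..b}}"
  by (subst closed_segment_same_Re) (auto simp: closed_segment_eq_real_ivl)

lemma closed_segment_horizontal:
  "a \<le> b \<Longrightarrow> closed_segment (Complex a s) (Complex b s) = {z. Im z = s \<and> Re z \<in> {a..b}}"
  by (subst closed_segment_same_Im) (auto simp: closed_segment_eq_real_ivl)

lemma closed_segment_horizontal':
  "a \<le> b \<Longrightarrow> closed_segment (Complex b s) (Complex a s) = {z. Im z = s \<and> Re z \<in> {a..b}}"
  using closed_segment_horizontal[of a b s] by (simp add: closed_segment_commute)

lemma segment_transform_reverse:
  "z \<notin> closed_segment a b \<Longrightarrow> segment_transform b a z = - segment_transform a b z"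
  unfolding segment_transform_def
  by (intro contour_integral_reverse_linepath segment_kernel_continuous)
     (simp add: closed_segment_commute)

text \<open>
  The boundary of the rectangle between the abscissae \<open>a\<close> and \<open>b\<close> consists
  of the left edge at \<open>a\<close>, the sides from \<open>a\<close> to \<open>b\<close>, and the
  left edge at \<open>b\<close> traversed upwards, hence the minus sign.
\<close>

lemma rectangle_transform:
  assumes "a \<le> b" and "z \<notin> path_image (rectpath (Complex a (-pi)) (Complex b pi))"
    and int: "((\<lambda>t. exp (exp t) / (t - z)) has_contour_integral I) (rectpath (Complex a (-pi)) (Complex b pi))"
  shows "edge_transform a z + sides_transform a b z - edge_transform b z = I"
proof -
  let ?g = "\<lambda>t. exp (exp t) / (t - z)"
  define a1 a2 a3 a4 where "a1 = Complex a (-pi)" and "a2 = Complex b (-pi)"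
    and "a3 = Complex b pi" and "a4 = Complex a pi"
  have rect: "rectpath a1 a3 = linepath a1 a2 +++ linepath a2 a3 +++ linepath a3 a4 +++ linepath a4 a1"
    by (simp add: rectpath_def a1_def a2_def a3_def a4_def Let_def)
  have im: "path_image (rectpath a1 a3) = closed_segment a1 a2 \<union> closed_segment a2 a3
      \<union> closed_segment a3 a4 \<union> closed_segment a4 a1"
    unfolding rect by (simp add: path_image_join Un_assoc)
  then have z: "z \<notin> closed_segment a1 a2" "z \<notin> closed_segment a2 a3"
      "z \<notin> closed_segment a3 a4" "z \<notin> closed_segment a4 a1"
    using assms(2) unfolding a1_def[symmetric] a3_def[symmetric] im by auto
  have i: "(?g has_contour_integral segment_transform p q z) (linepath p q)"
    if "z \<notin> closed_segment p q" for p q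
    unfolding segment_transform_def
    by (intro has_contour_integral_integral contour_integrable_continuous_linepath
          segment_kernel_continuous that)
  have "(?g has_contour_integral segment_transform a1 a2 z + (segment_transform a2 a3 z
      + (segment_transform a3 a4 z + segment_transform a4 a1 z))) (rectpath a1 a3)"
    unfolding rect by (intro has_contour_integral_join i z valid_path_join) auto
  then have "I = segment_transform a1 a2 z + (segment_transform a2 a3 z
      + (segment_transform a3 a4 z + segment_transform a4 a1 z))"
    using int has_contour_integral_unique unfolding a1_def a3_def by blast
  moreover have "segment_transform a2 a3 z = - segment_transform a3 a2 z"
    using z(2) by (intro segment_transform_reverse) (simp add: closed_segment_commute)
  ultimately show ?thesis
    by (simp add: edge_transform_def sides_transform_def a1_def a2_def a3_def a4_def)
qed

text \<open>
  Cauchy's theorem: the kernel is holomorphic on the rectangle when \<open>z\<close> lies outside.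
\<close>

lemma rectangle_transform_outside:
  assumes "a \<le> b" and z: "z \<notin> cbox (Complex a (-pi)) (Complex b pi)"
  shows "edge_transform a z + sides_transform a b z = edge_transform b z"
proof -
  have sub: "path_image (rectpath (Complex a (-pi)) (Complex b pi)) \<subseteq> cbox (Complex a (-pi)) (Complex b pi)"
    using assms pi_ge_zero by (intro path_image_rectpath_subset_cbox) auto
  have "((\<lambda>t. exp (exp t) / (t - z)) has_contour_integral 0) (rectpath (Complex a (-pi)) (Complex b pi))"
    by (rule Cauchy_theorem_convex_simple[where S = "cbox (Complex a (-pi)) (Complex b pi)"])
       (use z sub in \<open>auto intro!: holomorphic_intros\<close>)
  from rectangle_transform[OF \<open>a \<le> b\<close> _ this] z sub show ?thesis by auto
qed

lemma rectangle_transform_inside: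
  assumes z: "z \<in> box (Complex a (-pi)) (Complex b pi)"
  shows "edge_transform a z + sides_transform a b z - edge_transform b z = 2 * pi * \<i> * exp (exp z)"
proof -
  have ab: "a < b" "- pi < pi" using z by (auto simp: in_box_complex_iff)
  have sub: "path_image (rectpath (Complex a (-pi)) (Complex b pi)) \<subseteq>
      cbox (Complex a (-pi)) (Complex b pi) - box (Complex a (-pi)) (Complex b pi)"
    using ab by (subst path_image_rectpath_cbox_minus_box) auto
  have wn: "winding_number (rectpath (Complex a (-pi)) (Complex b pi)) z = 1"
    by (rule winding_number_rectpath[OF z])
  have "((\<lambda>t. exp (exp t) / (t - z)) has_contour_integral
      2 * pi * \<i> * winding_number (rectpath (Complex a (-pi)) (Complex b pi)) z * exp (exp z))
      (rectpath (Complex a (-pi)) (Complex b pi))"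
    by (rule Cauchy_integral_formula_convex_simple[where S = UNIV])
       (use z sub in \<open>auto intro!: holomorphic_intros\<close>)
  then show ?thesis
    unfolding wn using rectangle_transform[of a b z] ab z sub by auto
qed

lemma sides_transform_split:
  assumes "a \<le> b" "b \<le> c" and "\<bar>Im z\<bar> \<noteq> pi \<or> Re z < a"
  shows "sides_transform a c z = sides_transform a b z + sides_transform b c z"
proof -
  have 1: "z \<notin> closed_segment (Complex a (-pi)) (Complex c (-pi))"
    and 2: "z \<notin> closed_segment (Complex c pi) (Complex a pi)"
    using assms by (auto simp: closed_segment_horizontal closed_segment_horizontal')
  have "segment_transform (Complex a (-pi)) (Complex c (-pi)) z =
    segment_transform (Complex a (-pi)) (Complex b (-pi)) z + segment_transform (Complex b (-pi)) (Complex c (-pi)) z"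
    unfolding segment_transform_def
    by (intro contour_integral_split_linepath segment_kernel_continuous 1)
      (use assms in \<open>auto simp: closed_segment_horizontal\<close>)
  moreover have "segment_transform (Complex c pi) (Complex a pi) z =
    segment_transform (Complex c pi) (Complex b pi) z + segment_transform (Complex b pi) (Complex a pi) z"
    unfolding segment_transform_def
    by (intro contour_integral_split_linepath segment_kernel_continuous 2)
      (use assms in \<open>auto simp: closed_segment_horizontal'\<close>)
  ultimately show ?thesis by (simp add: sides_transform_def)
qed

text \<open>
  On the lines \<open>Im t = \<plusminus>pi\<close> the inner exponential is the negative number
  \<open>- exp (Re t)\<close>. The geometric bound is far from sharp but sums well.
\<close>

lemma norm_exp_exp_side:
  assumes "\<bar>Im t\<bar> = pi" "real n \<le> Re t"
  shows "norm (exp (exp t)) \<le> (1/2) ^ n"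
proof -
  have "cos (Im t) = -1" using assms(1) by (auto simp: abs_if split: if_splits)
      (metis cos_minus cos_pi minus_minus)
  then have "Re (exp t) = - exp (Re t)" by (simp add: Re_exp)
  also have "\<dots> \<le> - (real n * ln 2)"
  proof -
    have "real n * ln 2 \<le> real n * 1" by (intro mult_left_mono) (use ln_2_less_1 in auto)
    also have "\<dots> \<le> exp (Re t)" using assms(2) exp_ge_add_one_self[of "Re t"] by linarith
    finally show ?thesis by simp
  qed
  finally have "exp (Re (exp t)) \<le> exp (- (real n * ln 2))" by simp
  also have "\<dots> = (1/2) ^ n"
    by (simp add: exp_minus exp_of_nat_mult power_divide inverse_eq_divide)
  finally show ?thesis by simp
qed

lemma sides_transform_bound:
  assumes "\<And>t. \<bar>Im t\<bar> = pi \<Longrightarrow> Re t \<ge> n \<Longrightarrow> norm (t - z) \<ge> 1"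
  shows "norm (sides_transform (real n) (real (Suc n)) z) \<le> 2 * (1/2) ^ n"
proof -
  have z: "z \<notin> {t. \<bar>Im t\<bar> = pi \<and> Re t \<ge> n}" using assms[of z] by auto
  have "norm (segment_transform (Complex n (-pi)) (Complex (real (Suc n)) (-pi)) z)
      \<le> (1/2)^n * norm (Complex (real (Suc n)) (-pi) - Complex n (-pi))"
    by (intro segment_transform_bound)
       (use z in \<open>auto simp: closed_segment_horizontal simp del: norm_exp_eq_Re intro!: assms norm_exp_exp_side\<close>)
  moreover have "norm (segment_transform (Complex (real (Suc n)) pi) (Complex n pi) z)
      \<le> (1/2)^n * norm (Complex n pi - Complex (real (Suc n)) pi)"
    by (intro segment_transform_bound)
       (use z in \<open>auto simp: closed_segment_horizontal' simp del: norm_exp_eq_Re intro!: assms norm_exp_exp_side\<close>)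
  moreover have "norm (Complex (real (Suc n)) (-pi) - Complex n (-pi)) = 1"
    "norm (Complex n pi - Complex (real (Suc n)) pi) = 1"
    by (simp_all add: cmod_def)
  ultimately show ?thesis
    unfolding sides_transform_def
    using norm_triangle_ineq[of "segment_transform (Complex n (-pi)) (Complex (real (Suc n)) (-pi)) z"
        "segment_transform (Complex (real (Suc n)) pi) (Complex n pi) z"] by simp
qed

lemma summable_half_powers: "summable (\<lambda>n. c * (1/2::real) ^ n)"
  by (intro summable_mult summable_geometric) auto

text \<open>
  The Cauchy transform over the whole boundary of the half strip \<open>Re t > s\<close>,
  \<open>\<bar>Im t\<bar> < pi\<close>.
\<close>

definition halfstrip_transform :: "nat \<Rightarrow> complex \<Rightarrow> complex" where
  "halfstrip_transform s z =
     edge_transform (real s) z + (\<Sum>n. sides_transform (real (n + s)) (real (Suc (n + s))) z)"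

lemma sides_transform_summable:
  "summable (\<lambda>n. sides_transform (real (n + s)) (real (Suc (n + s))) z)"
proof -
  define N where "N = nat \<lceil>Re z\<rceil> + 1"
  have "norm (sides_transform (real n) (real (Suc n)) z) \<le> 2 * (1/2) ^ n" if "n \<ge> N" for n
  proof (rule sides_transform_bound)
    fix t assume t: "real n \<le> Re t"
    have "Re z + 1 \<le> real n" using that unfolding N_def by linarith
    then show "1 \<le> norm (t - z)" using t abs_Re_le_cmod[of "t - z"] by simp
  qed
  then have "summable (\<lambda>n. sides_transform (real n) (real (Suc n)) z)"
    by (intro summable_comparison_test[OF _ summable_half_powers[of 2]]) blast
  then show ?thesis by (subst summable_iff_shift)
qed

text \<open>
  Moving the left edge one unit to the right sweeps over a rectangle that does not contain
  \<open>z\<close>.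
\<close>

lemma halfstrip_transform_Suc:
  assumes "Re z < real s \<or> \<bar>Im z\<bar> > pi"
  shows "halfstrip_transform (Suc s) z = halfstrip_transform s z"
proof -
  have "z \<notin> cbox (Complex (real s) (-pi)) (Complex (real (Suc s)) pi)"
    using assms by (auto simp: in_cbox_complex_iff)
  then have "edge_transform (real s) z + sides_transform (real s) (real (Suc s)) z = edge_transform (real (Suc s)) z"
    by (intro rectangle_transform_outside) auto
  moreover have "(\<Sum>n. sides_transform (real (n + s)) (real (Suc (n + s))) z) =
     (\<Sum>n. sides_transform (real (n + Suc s)) (real (Suc (n + Suc s))) z) + sides_transform (real s) (real (Suc s)) z"
    using suminf_split_head[OF sides_transform_summable[of s z]] by simp
  ultimately show ?thesis
    unfolding halfstrip_transform_def by (simp add: algebra_simps)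
qed

lemma halfstrip_transform_shift:
  assumes "Re z < real s \<or> \<bar>Im z\<bar> > pi" "s \<le> s'"
  shows "halfstrip_transform s' z = halfstrip_transform s z"
  using assms(2)
proof (induction s' rule: dec_induct)
  case (step n)
  then have "halfstrip_transform (Suc n) z = halfstrip_transform n z"
    using assms by (intro halfstrip_transform_Suc) auto
  with step show ?case by simp
qed simp

text \<open>
  Here the left edge moves past \<open>z\<close>, and Cauchy's formula picks up the value of the
  integrand. Moving it in a single step from \<open>0\<close> to \<open>s\<close> avoids a case
  distinction for points on the intermediate edges.
\<close>

lemma halfstrip_transform_inside:
  assumes z: "0 < Re z" "Re z < real s" "\<bar>Im z\<bar> < pi"
  shows "halfstrip_transform 0 z = halfstrip_transform s z + 2 * pi * \<i> * exp (exp z)"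
proof -
  have sides: "(\<Sum>n<k. sides_transform (real n) (real (Suc n)) z) = sides_transform 0 (real k) z" for k
  proof (induction k)
    case 0
    show ?case by (simp add: sides_transform_def segment_transform_def)
  next
    case (Suc k)
    have "sides_transform 0 (real (Suc k)) z = sides_transform 0 (real k) z + sides_transform (real k) (real (Suc k)) z"
      using z by (intro sides_transform_split) auto
    with Suc show ?case by simp
  qed
  have "halfstrip_transform 0 z = edge_transform 0 z + (\<Sum>n. sides_transform (real n) (real (Suc n)) z)"
    by (simp add: halfstrip_transform_def)
  also have "(\<Sum>n. sides_transform (real n) (real (Suc n)) z) =
      (\<Sum>n. sides_transform (real (n + s)) (real (Suc (n + s))) z) + sides_transform 0 (real s) z"
    using suminf_split_initial_segment[of "\<lambda>n. sides_transform (real n) (real (Suc n)) z" s]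
      sides_transform_summable[of 0 z] sides[of s] by simp
  finally have "halfstrip_transform 0 z - halfstrip_transform s z =
      edge_transform 0 z + sides_transform 0 (real s) z - edge_transform (real s) z"
    by (simp add: halfstrip_transform_def)
  also have "\<dots> = 2 * pi * \<i> * exp (exp z)"
    by (intro rectangle_transform_inside) (use z in \<open>auto simp: in_box_complex_iff\<close>)
  finally show ?thesis by (simp add: algebra_simps)
qed

text \<open>
  The hypothesis lists the regions at distance at least \<open>1\<close> from the boundary of the
  half strip. The edge, of length \<open>2 * pi\<close> with \<open>\<bar>exp (exp t)\<bar> \<le>
  exp 1 \<le> 3\<close>, contributes at most \<open>6 * pi\<close>, and the sides at most
  \<open>4\<close>.
\<close>

lemma halfstrip_transform_bound:
  assumes "Re z \<le> -1 \<or> \<bar>Im z\<bar> \<ge> pi + 1 \<or> (Re z \<ge> 1 \<and> \<bar>Im z\<bar> \<le> pi - 1)"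
  shows "norm (halfstrip_transform 0 z) \<le> 8 * pi"
proof -
  have dist: "norm (t - z) \<ge> 1"
    if "\<bar>Im t\<bar> = pi \<and> Re t \<ge> 0 \<or> Re t = 0 \<and> \<bar>Im t\<bar> \<le> pi" for t
    using that assms abs_Re_le_cmod[of "t - z"] abs_Im_le_cmod[of "t - z"] pi_gt3
    by (auto simp: abs_if split: if_splits)
  have seg: "closed_segment (Complex 0 pi) (Complex 0 (-pi)) = {t. Re t = 0 \<and> Im t \<in> {-pi..pi}}"
    by (subst closed_segment_commute, subst closed_segment_vertical) auto
  have "norm (edge_transform 0 z) \<le> 3 * norm (Complex 0 (-pi) - Complex 0 pi)"
    unfolding edge_transform_def
  proof (rule segment_transform_bound)
    show "z \<notin> closed_segment (Complex 0 pi) (Complex 0 (- pi))"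
      using dist[of z] by (auto simp: seg abs_le_iff)
    fix t assume t: "t \<in> closed_segment (Complex 0 pi) (Complex 0 (- pi))"
    then show "1 \<le> norm (t - z)" by (intro dist) (auto simp: seg)
    have "Re (exp t) \<le> norm (exp t)" by (rule complex_Re_le_cmod)
    also have "\<dots> = 1" using t by (auto simp: seg)
    finally have "exp (Re (exp t)) \<le> exp 1" by simp
    also have "\<dots> \<le> 3" by (rule exp_le)
    finally show "norm (exp (exp t)) \<le> 3" by simp
  qed auto
  also have "norm (Complex 0 (-pi) - Complex 0 pi) = 2 * pi" by (simp add: cmod_def real_sqrt_mult)
  finally have edge: "norm (edge_transform 0 z) \<le> 6 * pi" by simp
  have sides: "norm (sides_transform (real n) (real (Suc n)) z) \<le> 2 * (1/2) ^ n" for n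
    by (intro sides_transform_bound dist) auto
  have "norm (\<Sum>n. sides_transform (real n) (real (Suc n)) z) \<le> (\<Sum>n. 2 * (1/2::real) ^ n)"
    by (intro norm_suminf_le sides summable_half_powers)
  also have "\<dots> = 4"
    by (subst suminf_mult[OF summable_geometric]) (auto simp: suminf_geometric)
  finally have "norm (halfstrip_transform 0 z) \<le> 6 * pi + 4"
    using edge norm_triangle_ineq[of "edge_transform 0 z" "\<Sum>n. sides_transform (real n) (real (Suc n)) z"]
    by (simp add: halfstrip_transform_def)
  then show ?thesis using pi_gt3 by simp
qed

text \<open>
  The half strip begins to the right of \<open>z\<close>. Its transform is then independent of the
  abscissa at which it begins, so that the values for different \<open>z\<close> continue one
  another analytically to the whole plane.
\<close>

definition strip_function :: "complex \<Rightarrow> complex" where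
  "strip_function z = - halfstrip_transform (nat \<lceil>Re z\<rceil> + 1) z / (2 * pi * \<i>)"

lemma strip_function_eq:
  assumes "Re z < real s"
  shows "strip_function z = - halfstrip_transform s z / (2 * pi * \<i>)"
proof -
  define s0 where "s0 = nat \<lceil>Re z\<rceil> + 1"
  have "Re z < real s0" unfolding s0_def by linarith
  then have "halfstrip_transform s0 z = halfstrip_transform s z"
    using halfstrip_transform_shift[of z s0 "max s s0"] halfstrip_transform_shift[of z s "max s s0"] assms
    by simp
  then show ?thesis by (simp add: strip_function_def s0_def)
qed

text \<open>
  On each half plane \<open>Re z < s\<close> a single transform with left edge at distance at least
  \<open>1\<close> represents the function.
\<close>

lemma strip_function_holomorphic: "strip_function holomorphic_on UNIV"
proof -
  have "strip_function holomorphic_on {z. Re z < real s}" for s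
  proof -
    let ?S = "{z. Re z < real s}"
    have sides: "sides_transform (real (n + Suc s)) (real (Suc (n + Suc s))) holomorphic_on ?S" for n
      unfolding sides_transform_def
      by (intro holomorphic_intros holomorphic_on_subset[OF segment_transform_holomorphic])
         (auto simp: closed_segment_horizontal closed_segment_horizontal')
    have edge: "edge_transform (real (Suc s)) holomorphic_on ?S"
      unfolding edge_transform_def
      by (intro holomorphic_on_subset[OF segment_transform_holomorphic])
         (auto simp: closed_segment_commute[of "Complex _ pi"] closed_segment_vertical)
    have "(\<lambda>z. \<Sum>n. sides_transform (real (n + Suc s)) (real (Suc (n + Suc s))) z) holomorphic_on ?S"
    proof (rule holomorphic_on_suminf[OF _ sides])
      show "open ?S" by (rule open_halfspace_Re_lt)
      show "summable (\<lambda>n. 2 * (1/2::real) ^ (n + Suc s))"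
        using summable_half_powers[of 2] by (subst summable_iff_shift)
      have "norm (sides_transform (real (n + Suc s)) (real (Suc (n + Suc s))) z) \<le> 2 * (1/2) ^ (n + Suc s)"
        if "z \<in> ?S" for n z
      proof (rule sides_transform_bound)
        fix t assume "real (n + Suc s) \<le> Re t"
        then show "1 \<le> norm (t - z)" using abs_Re_le_cmod[of "t - z"] that by simp
      qed
      then show "\<exists>N. \<forall>n\<ge>N. \<forall>z\<in>?S. norm z \<le> R \<longrightarrow>
         norm (sides_transform (real (n + Suc s)) (real (Suc (n + Suc s))) z) \<le> 2 * (1/2) ^ (n + Suc s)" for R
        by blast
    qed
    then have "(\<lambda>z. - halfstrip_transform (Suc s) z / (2 * pi * \<i>)) holomorphic_on ?S"
      unfolding halfstrip_transform_def by (intro holomorphic_intros edge) auto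
    moreover have "strip_function z = - halfstrip_transform (Suc s) z / (2 * pi * \<i>)" if "z \<in> ?S" for z
      using that by (intro strip_function_eq) auto
    ultimately show ?thesis by (metis (no_types, lifting) holomorphic_transform)
  qed
  moreover have "open {z. Re z < real s}" for s by (rule open_halfspace_Re_lt)
  ultimately have "strip_function holomorphic_on (\<Union>s. {z. Re z < real s})"
    by (intro holomorphic_on_UN_open) auto
  moreover have "(\<Union>s. {z. Re z < real s}) = UNIV"
    using reals_Archimedean2 by auto
  ultimately show ?thesis by simp
qed

lemma strip_function_bound_outside:
  assumes "Re z \<le> -1 \<or> \<bar>Im z\<bar> \<ge> pi + 1"
  shows "norm (strip_function z) \<le> 4"
proof -
  define s where "s = nat \<lceil>Re z\<rceil> + 1"
  have "Re z < real s" unfolding s_def by linarith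
  then have "strip_function z = - halfstrip_transform s z / (2 * pi * \<i>)" by (rule strip_function_eq)
  also have "halfstrip_transform s z = halfstrip_transform 0 z"
    using assms by (intro halfstrip_transform_shift) auto
  finally have "norm (strip_function z) = norm (halfstrip_transform 0 z) / (2 * pi)"
    by (simp add: norm_divide norm_mult)
  also have "\<dots> \<le> 4"
    using halfstrip_transform_bound[of z] assms by (auto simp: field_simps)
  finally show ?thesis .
qed

text \<open>
  Compared with the transform of the half strip that begins at \<open>0\<close>, which is bounded
  here, the function differs by the residue \<open>exp (exp z)\<close>; the sign in its definition
  makes this a positive contribution.
\<close>

lemma strip_function_inside:
  assumes "Re z \<ge> 1" "\<bar>Im z\<bar> \<le> pi - 1"
  shows "norm (strip_function z - exp (exp z)) \<le> 4"
proof -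
  define s where "s = nat \<lceil>Re z\<rceil> + 1"
  have s: "Re z < real s" unfolding s_def by linarith
  then have "strip_function z = - halfstrip_transform s z / (2 * pi * \<i>)" by (rule strip_function_eq)
  also have "halfstrip_transform s z = halfstrip_transform 0 z - 2 * pi * \<i> * exp (exp z)"
    using halfstrip_transform_inside[of z s] assms s by simp
  finally have "strip_function z - exp (exp z) = - halfstrip_transform 0 z / (2 * pi * \<i>)"
    by (simp add: field_simps)
  then have "norm (strip_function z - exp (exp z)) = norm (halfstrip_transform 0 z) / (2 * pi)"
    by (simp add: norm_divide norm_mult)
  also have "\<dots> \<le> 4"
    using halfstrip_transform_bound[of z] assms by (auto simp: field_simps)
  finally show ?thesis .
qed

section \<open>Fatou and Julia sets of trapped maps and limiting directions\<close>

lemma continuous_on_to_sphere: "continuous_on A to_sphere"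
proof -
  have "1 + complex_of_real (norm z) * of_real (norm z) \<noteq> 0" for z
  proof -
    have "1 + norm z * norm z \<noteq> 0" by (smt (verit) zero_le_square)
    then show ?thesis by (metis of_real_1 of_real_add of_real_eq_0_iff of_real_mult)
  qed
  moreover have "norm z * norm z + 1 \<noteq> 0" for z :: complex by (smt (verit) zero_le_square)
  ultimately show ?thesis
    unfolding to_sphere_def power2_eq_square
    by (intro continuous_intros) auto
qed

lemma funpow_invariant:
  assumes "\<And>w. w \<in> X \<Longrightarrow> f w \<in> X" "w \<in> X"
  shows "(f ^^ n) w \<in> X"
  using assms by (induction n) auto

lemma funpow_holomorphic_on:
  assumes "f holomorphic_on X" "\<And>w. w \<in> X \<Longrightarrow> f w \<in> X"
  shows "(f ^^ n) holomorphic_on X"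
proof (induction n)
  case 0
  then show ?case by (simp add: id_def)
next
  case (Suc n)
  have "f \<circ> (f ^^ n) holomorphic_on X"
    by (rule holomorphic_on_compose_gen[OF Suc assms(1)])
       (use funpow_invariant[of X f] assms(2) in auto)
  then show ?case by (simp add: o_def)
qed

text \<open>
  All iterates map \<open>X\<close> into the unit disc, so Montel's theorem yields locally uniformly
  convergent subsequences, and uniform continuity of the stereographic projection on the unit disc
  transfers the convergence to the chordal distance.
\<close>

lemma trapped_in_Fatou_set:
  assumes hol: "f holomorphic_on X" and bd: "\<And>w. w \<in> X \<Longrightarrow> norm (f w) \<le> 1"
    and disc: "cball 0 1 \<subseteq> X" and pole: "\<And>w. w \<in> X \<Longrightarrow> \<not> is_pole f w"
    and z: "ball z 1 \<subseteq> X"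
  shows "z \<in> Fatou_set f"
proof -
  have inv: "f w \<in> X" if "w \<in> X" for w
    using bd[OF that] disc by auto
  have bdn: "norm ((f ^^ n) w) \<le> 1" if "n \<ge> 1" "w \<in> X" for n w
  proof -
    obtain m where "n = Suc m" using \<open>n \<ge> 1\<close> by (cases n) auto
    moreover have "(f ^^ m) w \<in> X" by (rule funpow_invariant[OF inv \<open>w \<in> X\<close>])
    ultimately show ?thesis using bd by simp
  qed
  have "normal_family_on (ball z 1) {f ^^ n | n. n \<ge> 1}"
    unfolding normal_family_on_def
  proof (intro allI impI)
    fix h :: "nat \<Rightarrow> complex \<Rightarrow> complex" assume h: "\<forall>n. h n \<in> {f ^^ n | n. n \<ge> 1}"
    obtain g r where gr: "strict_mono (r :: nat \<Rightarrow> nat)"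
      "\<And>x. x \<in> ball z 1 \<Longrightarrow> ((\<lambda>n. h (r n) x) \<longlongrightarrow> g x) sequentially"
      "\<And>K. \<lbrakk>compact K; K \<subseteq> ball z 1\<rbrakk> \<Longrightarrow> uniform_limit K (h \<circ> r) g sequentially"
    proof (rule Montel[of "ball z 1" "{f ^^ n | n. n \<ge> 1}" h])
      fix h assume "h \<in> {f ^^ n | n. n \<ge> 1}"
      then show "h holomorphic_on ball z 1"
        using funpow_holomorphic_on[OF hol inv] holomorphic_on_subset[OF _ z] by auto
    next
      fix K assume "K \<subseteq> ball z 1"
      with z bdn show "\<exists>B. \<forall>h\<in>{f ^^ n | n. n \<ge> 1}. \<forall>w\<in>K. norm (h w) \<le> B"
        by (intro exI[of _ 1]) blast
    qed (use h in auto)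
    have hb: "norm (h n w) \<le> 1" if "w \<in> ball z 1" for n w
      using h that z bdn by (smt (verit, ccfv_SIG) mem_Collect_eq subsetD)
    have gb: "norm (g w) \<le> 1" if "w \<in> ball z 1" for w
      using Lim_norm_ubound[OF _ gr(2)[OF that], of 1] hb[OF that] by auto
    have "uniform_limit K (\<lambda>n w. to_sphere (h (r n) w)) (to_sphere \<circ> g) sequentially"
      if K: "compact K" "K \<subseteq> ball z 1" for K
    proof -
      have "uniformly_continuous_on (cball 0 1) to_sphere"
        by (intro compact_uniformly_continuous continuous_on_to_sphere compact_cball)
      then have "uniform_limit K (\<lambda>n w. to_sphere ((h \<circ> r) n w)) (to_sphere \<circ> g) sequentially"
        by (rule uniform_limit_compose[OF gr(3)[OF K]]) (use K hb gb in \<open>auto intro!: always_eventually simp: subset_iff\<close>)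
      then show ?thesis by (simp add: o_def)
    qed
    with gr(1) show "\<exists>r g. strict_mono r \<and> (\<forall>K. compact K \<and> K \<subseteq> ball z 1 \<longrightarrow>
        uniform_limit K (\<lambda>n w. to_sphere (h (r n) w)) g sequentially)"
      by blast
  qed
  moreover have "\<not> is_pole f ((f ^^ n) w)" if "w \<in> ball z 1" for w n
  proof (rule pole)
    show "(f ^^ n) w \<in> X"
      by (rule funpow_invariant[OF inv]) (use that z in auto)
  qed
  ultimately show ?thesis
    unfolding Fatou_set_def by (intro CollectI exI[of _ "ball z 1"] conjI ballI allI) simp_all
qed

text \<open>
  The orbit of the point hits a pole at once, with the zeroth iterate.
\<close>

lemma pole_in_Julia_set:
  assumes "is_pole f z"
  shows "z \<in> Julia_set f"
proof -
  have "is_pole f ((f ^^ 0) z)" using assms by simp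
  then show ?thesis unfolding Julia_set_def Fatou_set_def by blast
qed

text \<open>
  Makes precise that staying away from the north pole means staying bounded.
\<close>

lemma norm_le_of_snd_to_sphere:
  assumes "snd (to_sphere w) \<le> s" "s < 1"
  shows "norm w \<le> 2 / (1 - s)"
proof -
  have pos: "(norm w)\<^sup>2 + 1 > 0" by (smt (verit) zero_le_power2)
  have "((norm w)\<^sup>2 - 1) / ((norm w)\<^sup>2 + 1) \<le> s"
    using assms by (simp add: to_sphere_def)
  then have "(norm w)\<^sup>2 - 1 \<le> s * ((norm w)\<^sup>2 + 1)"
    using pos by (simp add: pos_divide_le_eq)
  then have "((norm w)\<^sup>2 + 1) * (1 - s) \<le> 2" by (simp add: algebra_simps)
  moreover have "norm w \<le> (norm w)\<^sup>2 + 1"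
    using zero_le_power2[of "norm w - 1/2"] zero_le_power2[of "norm w"]
    unfolding power2_diff by (simp add: power2_eq_square)
  then have "norm w * (1 - s) \<le> ((norm w)\<^sup>2 + 1) * (1 - s)"
    using assms(2) by (intro mult_right_mono) auto
  ultimately have "norm w * (1 - s) \<le> 2" by linarith
  then show ?thesis using assms(2) by (simp add: pos_le_divide_eq)
qed

lemma funpow_deriv_at_fixed_point:
  assumes "f z = z" "(f has_field_derivative c) (at z)"
  shows "((f ^^ n) has_field_derivative c ^ n) (at z)"
proof (induction n)
  case 0
  show ?case by (simp add: id_def)
next
  case (Suc n)
  have "(f ^^ n) z = z" using assms(1) by (induction n) auto
  then have "(f has_field_derivative c) (at ((f ^^ n) z))" using assms(2) by simp
  from DERIV_chain[OF this Suc] show ?case by (simp add: o_def)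
qed

text \<open>
  If a subsequence of the iterates converged near the fixed point in the chordal distance, the limit
  would map the fixed point to itself and, by continuity, stay away from infinity on a small disc.
  The iterates would then be uniformly bounded there and so, by Cauchy's estimate, would be their
  derivatives at the fixed point. But these are the powers of the multiplier.
\<close>

lemma repelling_fixed_point_in_Julia_set:
  assumes hol: "f holomorphic_on UNIV" and fp: "f z0 = z0" and rep: "norm (deriv f z0) > 1"
  shows "z0 \<in> Julia_set f"
proof (rule ccontr)
  assume "z0 \<notin> Julia_set f"
  then obtain U where U: "open U" "z0 \<in> U" "normal_family_on U {f ^^ n | n. n \<ge> 1}"
    unfolding Julia_set_def Fatou_set_def by blast
  have fixn: "(f ^^ n) z0 = z0" for n using fp by (induction n) auto
  have holn: "(f ^^ n) holomorphic_on UNIV" for n by (rule funpow_holomorphic_on[OF hol]) simp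
  have contn: "continuous_on A (f ^^ n)" for A n
    using holomorphic_on_imp_continuous_on[OF holn] continuous_on_subset by blast
  obtain r g where r: "strict_mono (r :: nat \<Rightarrow> nat)" and
    ul: "\<And>K. compact K \<Longrightarrow> K \<subseteq> U \<Longrightarrow>
      uniform_limit K (\<lambda>n z. to_sphere ((f ^^ Suc (r n)) z)) g sequentially"
  proof -
    define h where "h = (\<lambda>n. f ^^ Suc n)"
    have "\<forall>n. h n \<in> {f ^^ n | n. n \<ge> 1}"
    proof
      fix n :: nat
      have "Suc n \<ge> 1" by simp
      then show "h n \<in> {f ^^ n | n. n \<ge> 1}" unfolding h_def by blast
    qed
    then have "\<exists>r g. strict_mono r \<and> (\<forall>K. compact K \<and> K \<subseteq> U \<longrightarrow>
        uniform_limit K (\<lambda>n z. to_sphere (h (r n) z)) g sequentially)"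
      using U(3) unfolding normal_family_on_def by (elim allE[of _ h] impE)
    then show thesis using that unfolding h_def by auto
  qed
  obtain d where d: "d > 0" "cball z0 d \<subseteq> U"
    using U open_contains_cball by blast
  have uld: "uniform_limit (cball z0 d) (\<lambda>n z. to_sphere ((f ^^ Suc (r n)) z)) g sequentially"
    using d by (intro ul) auto
  have cont: "continuous_on (cball z0 d) g"
  proof (rule uniform_limit_theorem[OF _ uld])
    show "\<forall>\<^sub>F n in sequentially. continuous_on (cball z0 d) (\<lambda>z. to_sphere ((f ^^ Suc (r n)) z))"
      by (intro always_eventually allI continuous_on_compose2[OF continuous_on_to_sphere contn]) auto
  qed auto
  have "(\<lambda>n. to_sphere ((f ^^ Suc (r n)) z0)) \<longlonglongrightarrow> g z0"
    using tendsto_uniform_limitI[OF uld, of z0] d by simp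
  then have g0: "g z0 = to_sphere z0"
    unfolding fixn by (simp add: LIMSEQ_const_iff)
  define s where "s = snd (to_sphere z0)"
  have s: "s < 1"
    unfolding s_def to_sphere_def by (simp add: divide_less_eq) (smt (verit) zero_le_power2)
  obtain d' where d': "d' > 0" "d' \<le> d"
    "\<And>w. w \<in> cball z0 d' \<Longrightarrow> dist (g w) (g z0) < (1 - s) / 4"
  proof -
    have "(1 - s) / 4 > 0" using s by simp
    then obtain e where e: "e > 0" "\<And>w. w \<in> cball z0 d \<Longrightarrow> dist w z0 < e \<Longrightarrow> dist (g w) (g z0) < (1 - s) / 4"
      using cont[unfolded continuous_on_iff, rule_format, of z0 "(1 - s) / 4"] d by auto
    show ?thesis
      by (rule that[of "min d (e / 2)"]) (use e d in \<open>auto simp: dist_commute\<close>)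
  qed
  \<comment> \<open>Near the fixed point the images stay below the height \<open>(1 + s) / 2\<close>, halfway to the north pole.\<close>
  define B where "B = 2 / (1 - (1 + s) / 2)"
  have "\<forall>\<^sub>F n in sequentially. \<forall>w\<in>cball z0 d. dist (to_sphere ((f ^^ Suc (r n)) w)) (g w) < (1 - s) / 4"
    using uniform_limitD[OF uld, of "(1 - s) / 4"] s by simp
  then have ev: "\<forall>\<^sub>F n in sequentially. norm (deriv f z0) ^ Suc (r n) \<le> B / d'"
  proof eventually_elim
    case (elim n)
    have "norm ((f ^^ Suc (r n)) w) \<le> B" if w: "w \<in> cball z0 d'" for w
    proof -
      have "dist (to_sphere ((f ^^ Suc (r n)) w)) (to_sphere z0) < (1 - s) / 2"
      proof -
        have "w \<in> cball z0 d" using w d' by auto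
        then have "dist (to_sphere ((f ^^ Suc (r n)) w)) (g w) < (1 - s) / 4" using elim by blast
        moreover have "dist (g w) (to_sphere z0) < (1 - s) / 4" using d'(3)[OF w] g0 by simp
        moreover have "dist (to_sphere ((f ^^ Suc (r n)) w)) (to_sphere z0) \<le>
            dist (to_sphere ((f ^^ Suc (r n)) w)) (g w) + dist (g w) (to_sphere z0)"
          by (rule dist_triangle)
        ultimately show ?thesis by linarith
      qed
      then have "dist (snd (to_sphere ((f ^^ Suc (r n)) w))) s < (1 - s) / 2"
        unfolding s_def using dist_snd_le le_less_trans by blast
      then have "snd (to_sphere ((f ^^ Suc (r n)) w)) \<le> (1 + s) / 2"
        unfolding dist_real_def by (simp only: abs_less_iff) (auto simp: field_simps)
      then show ?thesis unfolding B_def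
        by (rule norm_le_of_snd_to_sphere) (use s in simp)
    qed
    then have "norm ((deriv ^^ 1) (f ^^ Suc (r n)) z0) \<le> fact 1 * B / d' ^ 1"
      using d' by (intro Cauchy_inequality contn holomorphic_on_subset[OF holn]) (auto simp: dist_norm)
    moreover have "deriv (f ^^ Suc (r n)) z0 = deriv f z0 ^ Suc (r n)"
      by (intro DERIV_imp_deriv funpow_deriv_at_fixed_point fp
          holomorphic_derivI[OF hol]) auto
    ultimately show ?case by (simp add: norm_power norm_mult)
  qed
  obtain m where m: "norm (deriv f z0) ^ m > B / d'"
    using real_arch_pow[OF rep] by blast
  have "\<forall>\<^sub>F n in sequentially. n \<ge> m" by (rule eventually_ge_at_top)
  with ev have "\<forall>\<^sub>F n in sequentially. False"
  proof eventually_elim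
    case (elim n)
    have "m \<le> Suc (r n)" using elim(2) seq_suble[OF r, of n] by simp
    then have "norm (deriv f z0) ^ m \<le> norm (deriv f z0) ^ Suc (r n)"
      using rep by (intro power_increasing) auto
    then show ?case using m elim(1) by simp
  qed
  then show False by simp
qed

lemma sgn_eq_cis_Arg2pi: "z \<noteq> 0 \<Longrightarrow> cis (Arg2pi z) = sgn z"
  using Arg2pi_eq[of z] by (simp add: sgn_eq cis_conv_exp field_simps)

lemma cis_Arg2pi_unit: "norm z = 1 \<Longrightarrow> cis (Arg2pi z) = z"
  by (subst sgn_eq_cis_Arg2pi) (auto simp: sgn_eq)

lemma Arg2pi_cis: "0 \<le> \<theta> \<Longrightarrow> \<theta> < 2 * pi \<Longrightarrow> Arg2pi (cis \<theta>) = \<theta>"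
  by (rule Arg2pi_unique[of 1]) (auto simp: cis_conv_exp)

text \<open>
  Replacing \<open>a\<close> by \<open>norm z\<close> moves the point on the ray by at most
  \<open>C\<close>, which accounts for the factor \<open>2\<close>.
\<close>

lemma sgn_close_to_direction:
  fixes z v :: complex
  assumes "norm (z - of_real a * v) \<le> C" "a \<ge> 0" "norm v = 1" "z \<noteq> 0"
  shows "norm (sgn z - v) \<le> 2 * C / norm z"
proof -
  have "\<bar>norm z - a\<bar> \<le> norm (z - of_real a * v)"
    using norm_triangle_ineq3[of z "of_real a * v"] assms by (simp add: norm_mult)
  then have 1: "norm (of_real (norm z - a) * v) \<le> C"
    using assms unfolding norm_mult norm_of_real by simp
  have "of_real (norm z) * (sgn z - v) = (z - of_real a * v) - of_real (norm z - a) * v"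
    using assms(4) by (simp add: sgn_eq algebra_simps)
  then have "norm z * norm (sgn z - v) = norm ((z - of_real a * v) - of_real (norm z - a) * v)"
    by (metis norm_mult norm_of_real abs_norm_cancel)
  also have "\<dots> \<le> C + C"
    using norm_triangle_ineq4[of "z - of_real a * v" "of_real (norm z - a) * v"] assms(1) 1 by linarith
  finally show ?thesis using assms(4) by (simp add: field_simps)
qed

text \<open>
  Compactness of \<open>cis ` E\<close> enters through its closedness: limits of directions of rays
  from \<open>E\<close> stay in \<open>E\<close>.
\<close>

lemma Julia_limiting_directions_eqI:
  assumes E: "E \<subseteq> {0..<2*pi}" and cpt: "compact (cis ` E)"
    and near: "\<And>z. z \<in> Julia_set f \<Longrightarrow> \<exists>v\<in>cis ` E. \<exists>a\<ge>0. norm (z - of_real a * v) \<le> C"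
    and far: "\<And>\<theta> n. \<theta> \<in> E \<Longrightarrow> \<exists>z\<in>Julia_set f. norm z > real n \<and> norm (sgn z - cis \<theta>) \<le> 1 / real (Suc n)"
  shows "Julia_limiting_directions f = E"
proof (intro equalityI subsetI)
  fix \<theta> assume "\<theta> \<in> Julia_limiting_directions f"
  then obtain z where \<theta>: "0 \<le> \<theta>" "\<theta> < 2 * pi"
    and z: "\<And>n. z n \<in> Julia_set f" "\<And>n. z n \<noteq> 0" "\<not> bounded (range z)"
    and lim: "(\<lambda>n. cis (Arg2pi (z n))) \<longlonglongrightarrow> cis \<theta>"
    unfolding Julia_limiting_directions_def Julia_limiting_direction_def by auto
  have "cis \<theta> \<in> closure (cis ` E)"
    unfolding closure_approachable
  proof (intro allI impI)
    fix e :: real assume e: "e > 0"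
    then obtain N where N: "\<And>n. n \<ge> N \<Longrightarrow> dist (cis (Arg2pi (z n))) (cis \<theta>) < e / 2"
      using lim[unfolded lim_sequentially] by (meson half_gt_zero)
    obtain n where n: "n \<ge> N" "norm (z n) > 4 * \<bar>C\<bar> / e"
    proof (rule ccontr)
      assume "\<not> thesis"
      then have bd: "\<And>n. n \<ge> N \<Longrightarrow> norm (z n) \<le> 4 * \<bar>C\<bar> / e" using that by force
      have "range z \<subseteq> z ` {..<N} \<union> cball 0 (4 * \<bar>C\<bar> / e)"
      proof
        fix w assume "w \<in> range z"
        then obtain k where "w = z k" by blast
        then show "w \<in> z ` {..<N} \<union> cball 0 (4 * \<bar>C\<bar> / e)"
          using bd[of k] by (cases "k < N") auto
      qed
      then have "bounded (range z)"
        by (rule bounded_subset[rotated]) (simp add: finite_imp_bounded)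
      with z show False by simp
    qed
    obtain v a where v: "v \<in> cis ` E" "a \<ge> 0" "norm (z n - of_real a * v) \<le> C"
      using near[OF z(1)[of n]] by blast
    have "norm (sgn (z n) - v) \<le> 2 * C / norm (z n)"
      by (rule sgn_close_to_direction[OF v(3,2) _ z(2)]) (use v in auto)
    also have "\<dots> \<le> 2 * \<bar>C\<bar> / norm (z n)" by (intro divide_right_mono) auto
    also have "\<dots> \<le> e / 2" using n e z(2)[of n] by (simp add: field_simps)
    finally have "dist v (sgn (z n)) \<le> e / 2" by (simp add: dist_norm norm_minus_commute)
    moreover have "dist (sgn (z n)) (cis \<theta>) < e / 2" using N[OF n(1)] z(2)[of n] by (simp add: sgn_eq_cis_Arg2pi)
    ultimately have "dist v (cis \<theta>) < e" using dist_triangle[of v "cis \<theta>" "sgn (z n)"] by linarith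
    with v(1) show "\<exists>v\<in>cis ` E. dist v (cis \<theta>) < e" by blast
  qed
  then obtain \<theta>' where \<theta>': "\<theta>' \<in> E" "cis \<theta> = cis \<theta>'"
    using compact_imp_closed[OF cpt] by auto
  have "\<theta> = \<theta>'"
    using Arg2pi_cis[of \<theta>] Arg2pi_cis[of \<theta>'] \<theta> \<theta>' E by auto
  with \<theta>' show "\<theta> \<in> E" by simp
next
  fix \<theta> assume \<theta>: "\<theta> \<in> E"
  obtain z where z: "\<And>n. z n \<in> Julia_set f" "\<And>n. norm (z n) > real n"
    "\<And>n. norm (sgn (z n) - cis \<theta>) \<le> 1 / real (Suc n)"
    using far[OF \<theta>] by metis
  have nz: "z n \<noteq> 0" for n using z(2)[of n] by auto
  have "\<not> bounded (range z)"
  proof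
    assume "bounded (range z)"
    then obtain B where "\<And>n. norm (z n) \<le> B" unfolding bounded_iff by auto
    then have "real n \<le> B" for n using z(2)[of n] by (meson less_imp_le less_le_trans)
    then show False using reals_Archimedean2[of B] by (meson not_le)
  qed
  moreover have "(\<lambda>n. cis (Arg2pi (z n))) \<longlonglongrightarrow> cis \<theta>"
  proof (rule Lim_transform_bound[where g = "\<lambda>n. 1 / real (Suc n)", THEN Lim_null[THEN iffD2]])
    show "\<forall>\<^sub>F n in sequentially. norm (cis (Arg2pi (z n)) - cis \<theta>) \<le> norm (1 / real (Suc n))"
      using z(3) by (simp add: sgn_eq_cis_Arg2pi nz)
    show "(\<lambda>n. 1 / real (Suc n)) \<longlonglongrightarrow> 0" by (rule lim_1_over_n[THEN LIMSEQ_Suc])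
  qed
  ultimately have "Julia_limiting_direction f \<theta>"
    unfolding Julia_limiting_direction_def using z nz by blast
  then show "\<theta> \<in> Julia_limiting_directions f"
    unfolding Julia_limiting_directions_def using \<theta> E by auto
qed

text \<open>
  Repetitions of points make the statement valid for finite sets as well.
\<close>

lemma dense_sequence:
  fixes S :: "complex set"
  assumes "S \<noteq> {}"
  obtains u :: "nat \<Rightarrow> complex" where "range u \<subseteq> S" "\<And>x e. x \<in> S \<Longrightarrow> e > 0 \<Longrightarrow> \<exists>k. dist (u k) x < e"
proof -
  obtain T where T: "countable T" "T \<subseteq> S" "S \<subseteq> closure T" using separable by blast
  then have "T \<noteq> {}" using assms by auto
  show ?thesis
  proof (rule that[of "from_nat_into T"])
    show "range (from_nat_into T) \<subseteq> S" using T \<open>T \<noteq> {}\<close> from_nat_into by blast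
    fix x e assume "x \<in> S" "(e::real) > 0"
    then obtain t where "t \<in> T" "dist t x < e" using T closure_approachable by blast
    then show "\<exists>k. dist (from_nat_into T k) x < e"
      by (metis T(1) from_nat_into_surj)
  qed
qed

section \<open>Fixed points and growth of perturbed double exponentials\<close>

text \<open>
  This form shows that \<open>log_plus\<close> is continuous on \<open>[0, \<infinity>)\<close>.
\<close>

lemma log_plus_eq: "x \<ge> 0 \<Longrightarrow> log_plus x = ln (max x 1)"
  by (cases "x = 0") (auto simp: log_plus_def max_def)

lemma log_plus_nonneg: "log_plus x \<ge> 0"
  by (simp add: log_plus_def)

lemma log_plus_mono: "0 \<le> x \<Longrightarrow> x \<le> y \<Longrightarrow> log_plus x \<le> log_plus y"
  by (simp add: log_plus_eq max_def)

text \<open>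
  Substitute \<open>exp w = \<omega> + u\<close> with \<open>\<bar>u\<bar> \<le> 1\<close>, where
  \<open>\<omega> = ln (A / c) + 2 * pi * \<i> * m\<close> for a large natural number
  \<open>m\<close>. Then \<open>c * exp (exp w) = A * exp u\<close>, while \<open>w = Ln (\<omega> +
  u)\<close> is nearly constant, equal to \<open>ln (2 * pi * m)\<close> up to a bounded error. With
  \<open>A = R + ln (2 * pi * m)\<close> the fixed point equation becomes \<open>A * (exp u - 1) =
  O(1)\<close>, which has a solution in the unit disc by the minimum modulus principle once
  \<open>A\<close> is large. At that point the derivative is about \<open>c * exp (exp w) * exp
  w\<close>, hence large. The imaginary part of \<open>w\<close> is at most \<open>pi / 2\<close> in
  modulus, which leaves room for a disc of radius \<open>1/2\<close> within the strip where the
  approximation holds.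
\<close>

lemma repelling_fixed_points_of_double_exponential:
  assumes c: "c > 0" and R: "R \<ge> 0" and hol: "\<phi> holomorphic_on UNIV"
    and approx: "\<And>w. Re w \<ge> 1 \<Longrightarrow> \<bar>Im w\<bar> \<le> pi - 1 \<Longrightarrow> norm (\<phi> w - of_real c * exp (exp w)) \<le> 3"
  shows "\<exists>w. Re w \<ge> B \<and> Re w \<ge> 1 \<and> \<bar>Im w\<bar> \<le> pi - 1 \<and> \<phi> w = w + of_real R \<and> norm (deriv \<phi> w) > 1"
proof -
  \<comment> \<open>On the unit circle \<open>exp u\<close> differs from \<open>1\<close>, hence by at least some \<open>c1 > 0\<close> by compactness.\<close>
  obtain c1 where c1: "c1 > 0" "\<And>u::complex. norm u = 1 \<Longrightarrow> c1 \<le> norm (exp u - 1)"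
  proof -
    have "compact (sphere 0 1 :: complex set)" "sphere 0 1 \<noteq> ({} :: complex set)" by auto
    moreover have "continuous_on (sphere 0 1) (\<lambda>u::complex. norm (exp u - 1))"
      by (intro continuous_intros)
    ultimately obtain v where v: "v \<in> sphere (0::complex) 1"
      "\<forall>u\<in>sphere (0::complex) 1. norm (exp v - 1) \<le> norm (exp u - 1)"
      using continuous_attains_inf[of "sphere 0 1" "\<lambda>u::complex. norm (exp u - 1)"] by blast
    have "exp v \<noteq> 1"
    proof
      assume "exp v = 1"
      then obtain n where "Re v = 0" "Im v = of_int (2 * n) * pi" by (auto simp: exp_eq_1)
      then have "\<bar>of_int (2 * n) * pi\<bar> = 1" using v(1) by (simp add: cmod_def)
      moreover have "n = 0 \<or> \<bar>of_int (2 * n) * pi\<bar> \<ge> 2 * pi"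
        by (auto simp: abs_mult)
      ultimately show False using pi_gt3 by auto
    qed
    then show ?thesis using v by (intro that[of "norm (exp v - 1)"]) auto
  qed
  \<comment> \<open>The bound \<open>12\<close> is twice the error \<open>6\<close> in \<open>close\<close> below.\<close>
  have "\<forall>\<^sub>F m in at_top. (R + ln (2 * pi * real m)) * c1 > 12 \<and>
      ln ((R + ln (2 * pi * real m)) / c) \<ge> 3 \<and>
      ln ((R + ln (2 * pi * real m)) / c) \<le> real m \<and>
      ln (pi * real m) \<ge> max B 12 \<and> m \<ge> 1 \<and> R + ln (2 * pi * real m) > 0"
    using c c1(1) R by (intro eventually_conj eventually_ge_at_top; real_asymp)
  then obtain m where m: "(R + ln (2 * pi * real m)) * c1 > 12"
      "ln ((R + ln (2 * pi * real m)) / c) \<ge> 3"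
      "ln ((R + ln (2 * pi * real m)) / c) \<le> real m"
      "ln (pi * real m) \<ge> max B 12" "m \<ge> 1" "R + ln (2 * pi * real m) > 0"
    unfolding eventually_at_top_linorder by blast
  define A where "A = R + ln (2 * pi * real m)"
  have Apos: "A > 0" using m(6) by (simp add: A_def)
  define N where "N = 2 * pi * real m"
  define \<omega> where "\<omega> = Complex (ln (A / c)) N"
  have N: "N \<ge> 6 * real m" using pi_gt3 unfolding N_def by (intro mult_right_mono) auto
  have exp_\<omega>: "of_real c * exp \<omega> = of_real A"
  proof -
    have "exp \<omega> = of_real (exp (ln (A / c))) * cis N"
      by (simp add: \<omega>_def exp_eq_polar)
    also have "cis N = 1" unfolding N_def
      by (metis cis_multiple_2pi Ints_of_nat mult.commute mult.assoc)
    also have "exp (ln (A / c)) = A / c" using m c by (simp add: A_def)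
    finally show ?thesis using c by simp
  qed
  have w: "\<omega> + u \<noteq> 0" "\<omega> + u \<notin> \<real>\<^sub>\<le>\<^sub>0" "\<bar>Im (Ln (\<omega> + u))\<bar> \<le> pi / 2"
      "Re (Ln (\<omega> + u)) \<ge> max B 12" "\<bar>Re (Ln (\<omega> + u)) - ln N\<bar> \<le> 1"
    if u: "norm u \<le> 1" for u
  proof -
    have re: "Re (\<omega> + u) > 0"
      using abs_Re_le_cmod[of u] u m by (simp add: \<omega>_def A_def)
    then show nz: "\<omega> + u \<noteq> 0" "\<omega> + u \<notin> \<real>\<^sub>\<le>\<^sub>0"
      by (metis less_irrefl zero_complex.sel(1)) (use re in \<open>auto simp: complex_nonpos_Reals_iff\<close>)
    show "\<bar>Im (Ln (\<omega> + u))\<bar> \<le> pi / 2"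
      using Re_Ln_pos_lt[OF nz(1)] re by simp
    have "norm (\<omega> + u) \<le> \<bar>ln (A / c)\<bar> + \<bar>N\<bar> + norm u"
      using norm_triangle_ineq[of \<omega> u] cmod_le[of \<omega>] by (simp add: \<omega>_def)
    also have "\<dots> \<le> 2 * N" using m N u by (simp add: A_def)
    finally have up: "norm (\<omega> + u) \<le> 2 * N" .
    have "N / 2 \<le> N - 1" using N m(5) by simp
    also have "\<dots> \<le> Im (\<omega> + u)" using abs_Im_le_cmod[of u] u by (simp add: \<omega>_def)
    also have "\<dots> \<le> norm (\<omega> + u)" using abs_Im_le_cmod[of "\<omega> + u"] by simp
    finally have lo: "N / 2 \<le> norm (\<omega> + u)" .
    have Npos: "N > 0" using N m by simp
    have Re_eq: "Re (Ln (\<omega> + u)) = ln (norm (\<omega> + u))" using nz by simp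
    have "ln (N / 2) \<le> ln (norm (\<omega> + u))" "ln (norm (\<omega> + u)) \<le> ln (2 * N)"
      using up lo Npos nz by (simp_all add: ln_le_cancel_iff)
    moreover have "ln (N / 2) = ln (pi * real m)" by (simp add: N_def)
    moreover have "ln (2 * N) = ln 2 + ln N" "ln (N / 2) = ln N - ln 2"
      using Npos by (simp_all add: ln_mult ln_div)
    ultimately show "Re (Ln (\<omega> + u)) \<ge> max B 12" "\<bar>Re (Ln (\<omega> + u)) - ln N\<bar> \<le> 1"
      unfolding Re_eq using m(4) ln_2_less_1 by linarith+
  qed
  define G where "G = (\<lambda>u. \<phi> (Ln (\<omega> + u)) - Ln (\<omega> + u) - of_real R)"
  have close: "norm (G u - of_real A * (exp u - 1)) \<le> 6" if u: "norm u \<le> 1" for u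
  proof -
    define l where "l = Ln (\<omega> + u)"
    have "of_real c * exp (exp l) = of_real c * exp \<omega> * exp u"
      unfolding l_def using w(1)[OF u] by (simp add: exp_add)
    also have "\<dots> = of_real A * exp u" unfolding exp_\<omega> ..
    finally have e: "of_real c * exp (exp l) = of_real A * exp u" .
    have "norm (\<phi> l - of_real c * exp (exp l)) \<le> 3"
      using w(3,4)[OF u] pi_gt3 by (intro approx) (auto simp: l_def)
    moreover have "norm (of_real (A - R) - l) \<le> 1 + 2"
    proof -
      have "norm (of_real (A - R) - l) \<le> \<bar>Re (of_real (A - R) - l)\<bar> + \<bar>Im (of_real (A - R) - l)\<bar>"
        by (rule cmod_le)
      also have "\<dots> \<le> 1 + 2"
        using w(3,5)[OF u] pi_less_4 by (simp add: l_def A_def N_def abs_minus_commute)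
      finally show ?thesis .
    qed
    moreover have "G u - of_real A * (exp u - 1) = (\<phi> l - of_real c * exp (exp l)) + (of_real (A - R) - l)"
      unfolding e by (simp add: G_def l_def algebra_simps)
    ultimately show ?thesis
      using norm_triangle_ineq[of "\<phi> l - of_real c * exp (exp l)" "of_real (A - R) - l"] by simp
  qed
  have holG: "G holomorphic_on cball 0 1"
    unfolding G_def
    by (intro holomorphic_intros holomorphic_on_compose_gen[OF _ hol, unfolded o_def])
       (use w in auto)
  \<comment> \<open>At the centre \<open>G\<close> is smaller than everywhere on the boundary circle.\<close>
  obtain u where u: "u \<in> ball 0 1" "G u = 0"
  proof (rule holomorphic_contract_to_zero[of 0 1 G])
    show "continuous_on (cball 0 1) G" by (rule holomorphic_on_imp_continuous_on[OF holG])
    show "G holomorphic_on ball 0 1" by (rule holomorphic_on_subset[OF holG]) auto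
    fix z :: complex assume "norm (0 - z) = 1"
    then have z: "norm z = 1" by simp
    have "norm (G 0) \<le> 6" using close[of 0] by simp
    also have "6 < A * c1 - 6" using m(1) by (simp add: A_def)
    also have "\<dots> \<le> A * norm (exp z - 1) - 6"
      using c1(2)[OF z] m(6) by (simp add: A_def)
    also have "\<dots> = norm (of_real A * (exp z - 1)) - 6"
      using Apos by (simp add: norm_mult)
    also have "\<dots> \<le> norm (G z)"
      using close[of z] z norm_triangle_ineq2[of "of_real A * (exp z - 1)" "G z"]
      by (simp add: norm_minus_commute)
    finally show "norm (G 0) < norm (G z)" .
  qed (use that in auto)
  define l where "l = Ln (\<omega> + u)"
  have u1: "norm u \<le> 1" using u by simp
  have l: "\<bar>Im l\<bar> \<le> pi / 2" "Re l \<ge> B" "Re l \<ge> 12"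
    using w(3,4)[OF u1] by (auto simp: l_def)
  have fp: "\<phi> l = l + of_real R" using u(2) by (simp add: G_def l_def algebra_simps)
  \<comment> \<open>Cauchy's estimate on a disc of radius \<open>1/2\<close> bounds the derivative of the error term.\<close>
  define err where "err = (\<lambda>w. \<phi> w - of_real c * exp (exp w))"
  have hol_err: "err holomorphic_on A" for A
    unfolding err_def by (intro holomorphic_intros holomorphic_on_subset[OF hol]) auto
  have err: "norm (err w) \<le> 3" if "norm (l - w) \<le> 1/2" for w
  proof -
    have "\<bar>Re l - Re w\<bar> \<le> 1/2" "\<bar>Im l - Im w\<bar> \<le> 1/2"
      using that abs_Re_le_cmod[of "l - w"] abs_Im_le_cmod[of "l - w"] by auto
    then show ?thesis unfolding err_def using l pi_gt3 by (intro approx) linarith+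
  qed
  have "norm ((deriv ^^ 1) err l) \<le> fact 1 * 3 / (1/2) ^ 1"
    by (intro Cauchy_inequality hol_err holomorphic_on_imp_continuous_on) (auto intro: err)
  then have derr: "norm (deriv err l) \<le> 6" by simp
  have "((\<lambda>w. err w + of_real c * exp (exp w)) has_field_derivative
      deriv err l + of_real c * (exp (exp l) * exp l)) (at l)"
    by (auto intro!: derivative_eq_intros holomorphic_derivI[OF hol_err[of UNIV]])
  then have "deriv \<phi> l = deriv err l + of_real c * exp (exp l) * exp l"
    by (intro DERIV_imp_deriv) (simp add: err_def mult.assoc)
  moreover have "norm (of_real c * exp (exp l) * exp l) \<ge> 9 * 1"
  proof -
    have "12 \<le> Re (l + of_real R)" using l R by simp
    also have "\<dots> \<le> norm (\<phi> l)" unfolding fp by (rule complex_Re_le_cmod)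
    also have "\<dots> \<le> 3 + norm (of_real c * exp (exp l))"
      using err[of l] norm_triangle_ineq2[of "\<phi> l" "of_real c * exp (exp l)"] by (simp add: err_def)
    finally have "9 \<le> norm (of_real c * exp (exp l))" by simp
    moreover have "1 \<le> norm (exp l)" using l by simp
    ultimately show ?thesis unfolding norm_mult[of _ "exp l"] by (intro mult_mono) auto
  qed
  ultimately have "norm (deriv \<phi> l) > 1"
    using derr norm_triangle_ineq2[of "of_real c * exp (exp l) * exp l" "- deriv err l"] by (simp add: add.commute)
  then show ?thesis using l fp pi_gt3 by (intro exI[of _ l]) auto
qed

lemma integrated_pole_count_entire:
  assumes "f holomorphic_on UNIV"
  shows "integrated_pole_count r f = 0"
proof -
  have "\<not> is_pole f z" for z
    using not_is_pole_holomorphic[OF open_UNIV _ assms] by simp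
  then have "pole_count t f = 0" for t by (simp add: pole_count_def)
  then show ?thesis by (simp add: integrated_pole_count_def)
qed

text \<open>
  On the circle of radius \<open>r\<close> the arc of angles between \<open>\<theta>\<close> and
  \<open>\<theta> + 1 / r\<close> stays within distance \<open>1\<close> of the ray, and \<open>ln
  \<bar>f\<bar>\<close> is there at least a constant multiple of \<open>exp r\<close>. The factor
  \<open>1 / r\<close> lost to the length of the arc is negligible.
\<close>

lemma infinite_lower_order_of_double_exponential:
  assumes c: "c > 0" and \<theta>: "0 \<le> \<theta>" "\<theta> < 2 * pi" and hol: "f holomorphic_on UNIV"
    and big: "\<And>w. Re w \<ge> 1 \<Longrightarrow> \<bar>Im w\<bar> \<le> pi - 1 \<Longrightarrow>
       norm (f (cis \<theta> * (w + of_real R))) \<ge> c * exp (Re (exp w)) - 3"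
  shows "lower_growth_order f = \<infinity>"
proof -
  define Y where "Y = (\<lambda>r. c * exp (exp (r - 1 - R) / 2) - 3)"
  have T: "nevanlinna_char r f \<ge> ln (Y r) / (2 * pi * r)"
    if r: "r \<ge> 1" "r \<ge> R + 2" "\<theta> + 1 / r \<le> 2 * pi" "Y r > 0" for r
  proof -
    let ?g = "\<lambda>t. log_plus (norm (f (of_real r * cis t)))"
    have "continuous_on UNIV ?g"
    proof -
      have "continuous_on UNIV f" by (rule holomorphic_on_imp_continuous_on[OF hol])
      then have "continuous_on UNIV (\<lambda>t. f (of_real r * cis t))"
        by (rule continuous_on_compose2[where g = f]) (intro continuous_intros subset_UNIV)+
      then have "continuous_on UNIV (\<lambda>t. max (norm (f (of_real r * cis t))) 1)"
        by (intro continuous_on_max continuous_on_norm continuous_on_const)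
      then have "continuous_on UNIV (\<lambda>t. ln (max (norm (f (of_real r * cis t))) 1))"
        by (rule continuous_on_ln)
           (intro ballI less_imp_neq[THEN not_sym], simp add: less_max_iff_disj)
      then show ?thesis by (simp add: log_plus_eq)
    qed
    then have int: "?g integrable_on {a..b}" for a b
      by (rule integrable_continuous_real[OF continuous_on_subset]) simp
    have ge: "ln (Y r) \<le> ?g t" if t: "t \<in> {\<theta>..\<theta> + 1 / r}" for t
    proof -
      define d where "d = t - \<theta>"
      define w where "w = of_real r * cis d - of_real R"
      have d: "0 \<le> d" "d \<le> 1 / r" "1 / r \<le> 1" using t r(1) by (auto simp: d_def)
      have sd: "0 \<le> sin d" "sin d \<le> d"
        using d pi_gt3 by (auto intro!: sin_ge_zero sin_x_le_x)
      have "0 \<le> cos d" using d pi_gt3 by (intro cos_ge_zero) auto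
      then have "(cos d)\<^sup>2 \<le> cos d" using cos_le_one[of d] by (simp add: power2_eq_square mult_left_le)
      then have "1 - cos d \<le> (sin d)\<^sup>2" using sin_cos_squared_add[of d] by linarith
      also have "\<dots> \<le> (1 / r)\<^sup>2" using sd d by (intro power_mono) auto
      also have "\<dots> \<le> 1 / r" using d power_decreasing[of 1 2 "1 / r"] r(1) by simp
      finally have "r * (1 - cos d) \<le> r * (1 / r)" using r by (intro mult_left_mono) auto
      then have Re_w: "Re w \<ge> r - 1 - R" using r by (simp add: w_def algebra_simps)
      have "r * sin d \<le> r * (1 / r)" using sd d r by (intro mult_left_mono) auto
      then have Im_w: "0 \<le> Im w" "Im w \<le> 1" using r sd by (auto simp: w_def)
      \<comment> \<open>The modulus of \<open>exp (exp w)\<close> is \<open>exp (exp (Re w) * cos (Im w))\<close>.\<close>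
      have "cos (pi / 3) \<le> cos (Im w)"
        using Im_w pi_gt3 by (intro cos_monotone_0_pi_le) auto
      then have "exp (r - 1 - R) * (1 / 2) \<le> exp (Re w) * cos (Im w)"
        using Re_w by (intro mult_mono) (auto simp: cos_60)
      then have "Y r \<le> c * exp (Re (exp w)) - 3"
        using c by (simp add: Y_def Re_exp)
      also have "\<dots> \<le> norm (f (cis \<theta> * (w + of_real R)))"
        using Re_w Im_w r pi_gt3 by (intro big) auto
      also have "cis \<theta> * (w + of_real R) = of_real r * cis t"
        by (simp add: w_def d_def mult.left_commute cis_mult)
      finally have "log_plus (Y r) \<le> ?g t" using r(4) by (intro log_plus_mono) auto
      then show ?thesis by (simp add: log_plus_def)
    qed
    have "ln (Y r) / r = integral {\<theta>..\<theta> + 1 / r} (\<lambda>t. ln (Y r))"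
      using r(1) by simp
    also have "\<dots> \<le> integral {\<theta>..\<theta> + 1 / r} ?g"
      by (intro integral_le int ge) auto
    also have "\<dots> \<le> integral {0..2 * pi} ?g"
      using \<theta> r by (intro integral_subset_le int) (auto simp: log_plus_nonneg)
    finally have "ln (Y r) / r / (2 * pi) \<le> proximity_fun r f"
      unfolding proximity_fun_def by (intro divide_right_mono) auto
    then show ?thesis
      by (simp add: nevanlinna_char_def integrated_pole_count_entire[OF hol] mult.commute)
  qed
  have lim: "filterlim (\<lambda>r. ln (ln (Y r) / (2 * pi * r)) / ln r) at_top at_top"
    unfolding Y_def using c by real_asymp
  have ev: "\<forall>\<^sub>F r in at_top. r \<ge> 2 \<and> r \<ge> R + 2 \<and> \<theta> + 1 / r \<le> 2 * pi \<and> Y r > 0 \<and> ln (Y r) / (2 * pi * r) > 0"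
  proof (intro eventually_conj eventually_ge_at_top)
    show "\<forall>\<^sub>F r in at_top. \<theta> + 1 / r \<le> 2 * pi" using \<theta> by real_asymp
    show "\<forall>\<^sub>F r in at_top. Y r > 0" unfolding Y_def using c by real_asymp
    show "\<forall>\<^sub>F r in at_top. ln (Y r) / (2 * pi * r) > 0" unfolding Y_def using c by real_asymp
  qed
  have "\<forall>\<^sub>F r in at_top. ereal M \<le> ereal (log_plus (nevanlinna_char r f) / ln r)" for M
    using ev lim[unfolded filterlim_at_top, rule_format, of M]
  proof eventually_elim
    case (elim r)
    have "ln (ln (Y r) / (2 * pi * r)) \<le> log_plus (ln (Y r) / (2 * pi * r))"
      by (simp add: log_plus_def)
    also have "\<dots> \<le> log_plus (nevanlinna_char r f)"
      using elim by (intro log_plus_mono T) auto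
    finally have "ln (ln (Y r) / (2 * pi * r)) / ln r \<le> log_plus (nevanlinna_char r f) / ln r"
      using elim by (intro divide_right_mono) auto
    with elim show ?case by simp
  qed
  then have "ereal M \<le> lower_growth_order f" for M
    unfolding lower_growth_order_def by (intro Liminf_bounded)
  then show ?thesis using ereal_top by blast
qed

section \<open>Superposition of half strips in prescribed directions\<close>

text \<open>
  Repetitions in the sequence of directions are permitted: the entire function uses only the first
  occurrence of each direction, the meromorphic one uses all of them.
\<close>

locale direction_sequence =
  fixes u :: "nat \<Rightarrow> complex"
  assumes norm_u: "norm (u k) = 1"
begin

definition fresh :: "nat \<Rightarrow> bool" where
  "fresh k \<longleftrightarrow> (\<forall>j<k. u j \<noteq> u k)"

text \<open>
  Strips in distinct directions meet only near the origin. Starting the \<open>k\<close>-th strip at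
  a distance inversely proportional to the smallest gap between its direction and the earlier ones
  makes all strips disjoint.
\<close>

definition shift :: "nat \<Rightarrow> real" where
  "shift k = real k + 20 + (\<Sum>j<k. 100 / norm (u j - u k))"

text \<open>
  The rotation and translation that carry the \<open>k\<close>-th strip to the standard half strip.
\<close>

definition coord :: "nat \<Rightarrow> complex \<Rightarrow> complex" where
  "coord k z = cnj (u k) * z - of_real (shift k)"

definition strip :: "nat \<Rightarrow> complex set" where
  "strip k = {z. Re (coord k z) > -1 \<and> \<bar>Im (coord k z)\<bar> < pi + 1}"

text \<open>
  The weight \<open>(1/2) ^ k / 8\<close> makes the terms at most \<open>(1/2) ^ Suc k\<close> off
  their strips, because the strip function is bounded by \<open>4\<close>; these bounds add up to
  \<open>1\<close>. The factor \<open>u k\<close> makes the sum map the axis of the strip close to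
  itself.
\<close>

definition strip_term :: "nat \<Rightarrow> complex \<Rightarrow> complex" where
  "strip_term k z =
     (if fresh k then of_real ((1/2) ^ k / 8) * u k * strip_function (coord k z) else 0)"

definition strip_sum :: "complex \<Rightarrow> complex" where
  "strip_sum z = (\<Sum>k. strip_term k z)"

lemma u_cnj: "u k * cnj (u k) = 1"
  using norm_u[of k] by (simp add: complex_norm_square[symmetric])

lemma coord_inverse: "coord k (u k * (w + of_real (shift k))) = w"
proof -
  have "coord k (u k * (w + of_real (shift k))) = (u k * cnj (u k)) * (w + of_real (shift k)) - of_real (shift k)"
    by (simp add: coord_def mult_ac)
  then show ?thesis by (simp add: u_cnj)
qed

lemma inverse_coord: "u k * (coord k z + of_real (shift k)) = z"
  using u_cnj[of k] by (simp add: coord_def mult.assoc[symmetric])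

lemma shift_ge: "shift k \<ge> real k + 20"
  unfolding shift_def by (simp add: sum_nonneg)

lemma shift_ge_separation:
  assumes "j < k"
  shows "100 / norm (u j - u k) \<le> shift k - 20"
proof -
  have "100 / norm (u j - u k) \<le> (\<Sum>j<k. 100 / norm (u j - u k))"
    by (rule member_le_sum) (use assms in auto)
  then show ?thesis by (simp add: shift_def)
qed

lemma Re_coord_le: "Re (coord k z) \<le> norm z - shift k"
  using complex_Re_le_cmod[of "cnj (u k) * z"] norm_u[of k] by (simp add: coord_def norm_mult)

lemma not_in_strip_of_small: "norm z \<le> real k + 19 \<Longrightarrow> z \<notin> strip k"
  using Re_coord_le[of k z] shift_ge[of k] by (simp add: strip_def)

lemma near_ray_of_strip:
  assumes "z \<in> strip k"
  shows "norm (z - of_real (Re (coord k z) + shift k) * u k) \<le> pi + 1"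
proof -
  have "z - of_real (Re (coord k z) + shift k) * u k = u k * (coord k z - of_real (Re (coord k z)))"
    by (subst (1) inverse_coord[of k z, symmetric]) (simp add: algebra_simps)
  also have "coord k z - of_real (Re (coord k z)) = \<i> * of_real (Im (coord k z))"
    by (simp add: complex_eq_iff)
  finally show ?thesis
    using assms by (simp add: norm_mult norm_u strip_def)
qed

text \<open>
  A common point lies within \<open>pi + 1\<close> of both rays, say at \<open>a * u k\<close> and
  \<open>b * u j\<close>. Then \<open>a * \<bar>u j - u k\<bar>\<close> is at most twice the
  distance of these two points, which contradicts \<open>a \<ge> shift k - 1\<close>.
\<close>

lemma strips_disjoint_aux:
  assumes "j < k" "fresh k" "z \<in> strip j"
  shows "z \<notin> strip k"
proof
  assume z: "z \<in> strip k"
  define a where "a = Re (coord k z) + shift k"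
  define b where "b = Re (coord j z) + shift j"
  have ab: "a \<ge> shift k - 1" "a \<ge> 0" "b \<ge> 0"
    using z assms(3) shift_ge[of k] shift_ge[of j] by (auto simp: a_def b_def strip_def)
  have "norm (of_real a * u k - of_real b * u j) \<le>
      norm (z - of_real b * u j) + norm (z - of_real a * u k)"
    using norm_triangle_ineq4[of "z - of_real b * u j" "z - of_real a * u k"] by simp
  also have "\<dots> \<le> 2 * (pi + 1)"
    using near_ray_of_strip[OF z] near_ray_of_strip[OF assms(3)] by (simp add: a_def b_def)
  finally have 1: "norm (of_real a * u k - of_real b * u j) \<le> 10" using pi_less_4 by simp
  moreover have "\<bar>a - b\<bar> \<le> norm (of_real a * u k - of_real b * u j)"
    using norm_triangle_ineq3[of "of_real a * u k" "of_real b * u j"] ab by (simp add: norm_mult norm_u)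
  moreover have "of_real a * (u j - u k) = of_real (a - b) * u j - (of_real a * u k - of_real b * u j)"
    by (simp add: algebra_simps)
  then have "norm (of_real a * (u j - u k)) \<le> \<bar>a - b\<bar> + norm (of_real a * u k - of_real b * u j)"
    using norm_triangle_ineq4[of "of_real (a - b) * u j" "of_real a * u k - of_real b * u j"]
    by (simp only: norm_mult norm_u norm_of_real mult_1_right)
  ultimately have "a * norm (u j - u k) \<le> 20"
    using ab by (simp add: norm_mult)
  moreover have pos: "norm (u j - u k) > 0" using assms by (auto simp: fresh_def)
  moreover have "100 \<le> (shift k - 20) * norm (u j - u k)"
    using shift_ge_separation[OF assms(1)] pos by (simp add: pos_divide_le_eq)
  moreover have "(shift k - 20) * norm (u j - u k) \<le> a * norm (u j - u k)"
    using ab by (intro mult_right_mono) auto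
  ultimately show False by linarith
qed

lemma strips_disjoint: "fresh j \<Longrightarrow> fresh k \<Longrightarrow> j \<noteq> k \<Longrightarrow> z \<in> strip j \<Longrightarrow> z \<notin> strip k"
  using strips_disjoint_aux[of j k z] strips_disjoint_aux[of k j z] by (auto simp: neq_iff)

lemma strip_term_holomorphic: "strip_term k holomorphic_on S"
proof -
  have "(\<lambda>z. strip_function (coord k z)) holomorphic_on S"
    unfolding coord_def
    by (intro holomorphic_on_compose_gen[OF _ strip_function_holomorphic, unfolded o_def] holomorphic_intros) auto
  then have "(\<lambda>z. of_real ((1/2) ^ k / 8) * u k * strip_function (coord k z)) holomorphic_on S"
    by (intro holomorphic_intros)
  then show ?thesis
    by (cases "fresh k") (simp_all add: strip_term_def[abs_def])
qed

lemma strip_term_bound: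
  assumes "z \<notin> strip k"
  shows "norm (strip_term k z) \<le> (1/2) ^ Suc k"
proof (cases "fresh k")
  case True
  have "norm (strip_function (coord k z)) \<le> 4"
    by (rule strip_function_bound_outside) (use assms in \<open>auto simp: strip_def\<close>)
  with True show ?thesis by (simp add: strip_term_def norm_mult norm_u norm_divide norm_power)
qed (simp add: strip_term_def)

lemma strip_term_eventually_bound:
  "\<exists>N. \<forall>k\<ge>N. \<forall>z\<in>S. norm z \<le> R \<longrightarrow> norm (strip_term k z) \<le> (1/2) ^ Suc k"
proof -
  obtain N where N: "real N \<ge> R" using real_arch_simple by blast
  have "norm (strip_term k z) \<le> (1/2) ^ Suc k" if "k \<ge> N" "norm z \<le> R" for k z
    by (intro strip_term_bound not_in_strip_of_small) (use that N in linarith)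
  then show ?thesis by blast
qed

lemma summable_weights: "summable (\<lambda>k. (1/2::real) ^ Suc k)"
  using power_half_series by (rule sums_summable)

lemma strip_sum_holomorphic: "strip_sum holomorphic_on S"
proof -
  have "(\<lambda>z. \<Sum>k. strip_term k z) holomorphic_on UNIV"
    by (rule holomorphic_on_suminf[OF open_UNIV strip_term_holomorphic summable_weights
          strip_term_eventually_bound])
  then show ?thesis unfolding strip_sum_def using holomorphic_on_subset by blast
qed

lemma strip_term_summable: "summable (\<lambda>k. strip_term k z)"
proof -
  obtain N where "\<forall>k\<ge>N. norm (strip_term k z) \<le> (1/2) ^ Suc k"
    using strip_term_eventually_bound[of UNIV "norm z"] by blast
  then show ?thesis
    by (intro summable_comparison_test[OF _ summable_weights]) blast
qed

lemma strip_sum_bound_outside: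
  assumes "\<And>k. fresh k \<Longrightarrow> z \<notin> strip k"
  shows "norm (strip_sum z) \<le> 1"
proof -
  have "norm (strip_term k z) \<le> (1/2) ^ Suc k" for k
    using assms[of k] strip_term_bound[of z k] by (cases "fresh k") (auto simp: strip_term_def)
  then have "norm (strip_sum z) \<le> (\<Sum>k. (1/2::real) ^ Suc k)"
    unfolding strip_sum_def by (intro norm_suminf_le summable_weights)
  also have "\<dots> = 1" using power_half_series by (rule sums_unique[symmetric])
  finally show ?thesis .
qed

text \<open>
  A point of one strip lies off all the others.
\<close>

lemma strip_sum_dominant_term:
  assumes "fresh k" "z \<in> strip k"
  shows "norm (strip_sum z - strip_term k z) \<le> 1"
proof -
  have "(\<lambda>j. strip_term j z) sums strip_sum z"
    unfolding strip_sum_def by (rule summable_sums[OF strip_term_summable])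
  moreover have "(\<lambda>j. if j = k then strip_term j z else 0) sums strip_term k z"
    by (rule sums_single)
  ultimately have diff: "(\<lambda>j. strip_term j z - (if j = k then strip_term j z else 0)) sums
      (strip_sum z - strip_term k z)" by (rule sums_diff)
  have "norm (strip_term j z - (if j = k then strip_term j z else 0)) \<le> (1/2) ^ Suc j" for j
  proof (cases "j = k \<or> \<not> fresh j")
    case True
    then show ?thesis by (auto simp: strip_term_def)
  next
    case False
    then have "z \<notin> strip j" using strips_disjoint[OF assms(1) _ _ assms(2), of j] by auto
    then show ?thesis using strip_term_bound[of z j] False by simp
  qed
  then have "norm (strip_sum z - strip_term k z) \<le> (\<Sum>k. (1/2::real) ^ Suc k)"
    unfolding sums_unique[OF diff] by (intro norm_suminf_le summable_weights)
  also have "\<dots> = 1" using power_half_series by (rule sums_unique[symmetric])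
  finally show ?thesis .
qed

lemma strip_sum_in_core:
  assumes k: "fresh k" and w: "Re w \<ge> 1" "\<bar>Im w\<bar> \<le> pi - 1"
  shows "norm (cnj (u k) * strip_sum (u k * (w + of_real (shift k))) -
      of_real ((1/2) ^ k / 8) * exp (exp w)) \<le> 3"
proof -
  define z where "z = u k * (w + of_real (shift k))"
  have cz: "coord k z = w" unfolding z_def by (rule coord_inverse)
  have "z \<in> strip k" using w by (simp add: strip_def cz)
  then have 1: "norm (cnj (u k) * (strip_sum z - strip_term k z)) \<le> 1"
    using strip_sum_dominant_term[OF k, of z] by (simp add: norm_mult norm_u)
  define q where "q = (1/2::real) ^ k / 8"
  have q: "0 \<le> q" "q \<le> 1 / 8"
    unfolding q_def using power_le_one[of "1/2::real" k] by auto
  have "norm (of_real q * (strip_function w - exp (exp w))) \<le> q * 4"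
    using strip_function_inside[OF w] q by (simp add: norm_mult mult_left_mono)
  then have 2: "norm (of_real q * (strip_function w - exp (exp w))) \<le> 1" using q by linarith
  have "cnj (u k) * strip_term k z = (u k * cnj (u k)) * (of_real q * strip_function w)"
    using k by (simp add: strip_term_def cz q_def)
  also have "\<dots> = of_real q * strip_function w" by (simp add: u_cnj)
  finally have eq: "cnj (u k) * strip_sum z - of_real q * exp (exp w) =
      cnj (u k) * (strip_sum z - strip_term k z) + of_real q * (strip_function w - exp (exp w))"
    by (simp add: algebra_simps)
  have "norm (cnj (u k) * strip_sum z - of_real q * exp (exp w)) \<le> 3"
    unfolding eq using norm_triangle_ineq[of "cnj (u k) * (strip_sum z - strip_term k z)"
        "of_real q * (strip_function w - exp (exp w))"] 1 2 by linarith
  then show ?thesis by (simp only: z_def q_def)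
qed

text \<open>
  The set \<open>X\<close> off all strips contains the unit disc and is mapped into it.
\<close>

lemma Julia_set_near_rays:
  assumes "z \<in> Julia_set strip_sum"
  shows "\<exists>k. \<exists>a\<ge>0. norm (z - of_real a * u k) \<le> pi + 2"
proof -
  define X where "X = {w. \<forall>k. fresh k \<longrightarrow> w \<notin> strip k}"
  have "\<not> ball z 1 \<subseteq> X"
  proof
    assume "ball z 1 \<subseteq> X"
    then have "z \<in> Fatou_set strip_sum"
    proof (rule trapped_in_Fatou_set[rotated -1])
      show "strip_sum holomorphic_on X" by (rule strip_sum_holomorphic)
      show "norm (strip_sum w) \<le> 1" if "w \<in> X" for w
        using that by (intro strip_sum_bound_outside) (auto simp: X_def)
      show "cball 0 1 \<subseteq> X"
        using not_in_strip_of_small by (auto simp: X_def)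
      show "\<not> is_pole strip_sum w" for w
        using not_is_pole_holomorphic[OF open_UNIV _ strip_sum_holomorphic] by simp
    qed
    with assms show False by (simp add: Julia_set_def)
  qed
  then obtain y k where y: "y \<in> ball z 1" "y \<in> strip k" by (auto simp: X_def)
  define a where "a = Re (coord k y) + shift k"
  have "a \<ge> 0" using y(2) shift_ge[of k] by (simp add: a_def strip_def)
  moreover have "norm (z - of_real a * u k) \<le> norm (y - of_real a * u k) + norm (z - y)"
    using norm_triangle_ineq[of "y - of_real a * u k" "z - y"] by simp
  then have "norm (z - of_real a * u k) \<le> pi + 2"
    using near_ray_of_strip[OF y(2)] y(1) by (simp add: a_def dist_norm)
  ultimately show ?thesis by blast
qed

lemma repelling_fixed_points_in_strip:
  assumes k: "fresh k"
  shows "\<exists>z. z \<in> Julia_set strip_sum \<and> strip_sum z = z \<and> z \<in> strip k \<and> norm z > B"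
proof -
  define \<phi> where "\<phi> = (\<lambda>w. cnj (u k) * strip_sum (u k * (w + of_real (shift k))))"
  have hol: "\<phi> holomorphic_on UNIV" unfolding \<phi>_def
    by (intro holomorphic_intros
        holomorphic_on_compose_gen[OF _ strip_sum_holomorphic[of UNIV], unfolded o_def]) auto
  obtain w where w: "Re w \<ge> B" "Re w \<ge> 1" "\<bar>Im w\<bar> \<le> pi - 1" "\<phi> w = w + of_real (shift k)" "norm (deriv \<phi> w) > 1"
  proof -
    have "\<exists>w. Re w \<ge> B \<and> Re w \<ge> 1 \<and> \<bar>Im w\<bar> \<le> pi - 1 \<and>
        \<phi> w = w + of_real (shift k) \<and> norm (deriv \<phi> w) > 1"
    proof (rule repelling_fixed_points_of_double_exponential[OF _ _ hol])
      show "(1/2::real) ^ k / 8 > 0" "shift k \<ge> 0" using shift_ge[of k] by auto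
      show "norm (\<phi> w - of_real ((1/2) ^ k / 8) * exp (exp w)) \<le> 3"
        if "Re w \<ge> 1" "\<bar>Im w\<bar> \<le> pi - 1" for w
        unfolding \<phi>_def by (rule strip_sum_in_core[OF k that])
    qed
    then show thesis using that by blast
  qed
  define z where "z = u k * (w + of_real (shift k))"
  have cz: "coord k z = w" unfolding z_def by (rule coord_inverse)
  have "u k * \<phi> w = (u k * cnj (u k)) * strip_sum z" by (simp add: \<phi>_def z_def)
  then have fp: "strip_sum z = z" unfolding w(4) u_cnj by (simp add: z_def)
  have "(strip_sum has_field_derivative deriv strip_sum z) (at (u k * (w + of_real (shift k))))"
    unfolding z_def[symmetric] by (rule holomorphic_derivI[OF strip_sum_holomorphic[of UNIV]]) auto
  moreover have "((\<lambda>w. u k * (w + of_real (shift k))) has_field_derivative u k) (at w)"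
    by (auto intro!: derivative_eq_intros)
  ultimately have "((\<lambda>w. strip_sum (u k * (w + of_real (shift k)))) has_field_derivative
      deriv strip_sum z * u k) (at w)"
    by (rule DERIV_chain2)
  then have "((\<lambda>w. cnj (u k) * strip_sum (u k * (w + of_real (shift k)))) has_field_derivative
      cnj (u k) * (deriv strip_sum z * u k)) (at w)"
    by (rule DERIV_cmult)
  then have "deriv \<phi> w = cnj (u k) * (deriv strip_sum z * u k)"
    unfolding \<phi>_def by (rule DERIV_imp_deriv)
  then have "norm (deriv strip_sum z) > 1"
    using w(5) by (simp add: norm_mult norm_u)
  then have "z \<in> Julia_set strip_sum"
    by (intro repelling_fixed_point_in_Julia_set strip_sum_holomorphic fp)
  moreover have "z \<in> strip k" using w by (simp add: strip_def cz)
  moreover have "norm z > B"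
    using Re_coord_le[of k z] w(1) shift_ge[of k] unfolding cz by linarith
  ultimately show ?thesis using fp by blast
qed

lemma fresh_0: "fresh 0"
  by (simp add: fresh_def)

text \<open>
  Omitting repeated directions loses none of them.
\<close>

lemma ex_fresh: "\<exists>j. fresh j \<and> u j = u k"
proof -
  define j where "j = (LEAST j. u j = u k)"
  have "u j = u k" unfolding j_def by (rule LeastI) simp
  moreover have "fresh j"
    unfolding fresh_def \<open>u j = u k\<close> unfolding j_def by (intro allI impI not_less_Least)
  ultimately show ?thesis by blast
qed

text \<open>
  A polynomial with infinitely many fixed points would be the identity, which is not bounded by
  \<open>1\<close> at the point \<open>2\<close> off all strips.
\<close>

lemma strip_sum_transcendental: "transcendental_entire strip_sum"
proof -
  have "\<not> (\<exists>p. \<forall>z. strip_sum z = poly p z)"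
  proof
    assume "\<exists>p. \<forall>z. strip_sum z = poly p z"
    then obtain p where p: "\<And>z. strip_sum z = poly p z" by blast
    \<comment> \<open>The zeros of \<open>p - [:0, 1:]\<close> are the fixed points.\<close>
    let ?F = "{z. poly (p - [:0, 1:]) z = 0}"
    have "\<not> bounded ?F"
    proof
      assume "bounded ?F"
      then obtain B where "\<And>z. z \<in> ?F \<Longrightarrow> norm z \<le> B" unfolding bounded_iff by blast
      moreover obtain z where "strip_sum z = z" "norm z > B"
        using repelling_fixed_points_in_strip[OF fresh_0] by blast
      moreover have "z \<in> ?F" using \<open>strip_sum z = z\<close> p by simp
      ultimately show False by fastforce
    qed
    then have "p - [:0, 1:] = 0"
      using poly_roots_finite finite_imp_bounded by blast
    then have "strip_sum 2 = 2" using p by simp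
    moreover have "norm (strip_sum 2) \<le> 1"
      by (intro strip_sum_bound_outside not_in_strip_of_small) simp
    ultimately show False by simp
  qed
  then show ?thesis
    unfolding transcendental_entire_def using strip_sum_holomorphic by blast
qed

lemma strip_sum_lower_order: "lower_growth_order strip_sum = \<infinity>"
proof -
  define \<theta> where "\<theta> = Arg2pi (u 0)"
  have u0: "u 0 = cis \<theta>"
    using cis_Arg2pi_unit[OF norm_u[of 0]] by (simp add: \<theta>_def)
  show ?thesis
  proof (rule infinite_lower_order_of_double_exponential[of "1/8" \<theta> _ "shift 0"])
    fix w assume w: "1 \<le> Re w" "\<bar>Im w\<bar> \<le> pi - 1"
    have "norm (of_real (1/8) * exp (exp w)) - norm (cnj (u 0) * strip_sum (u 0 * (w + of_real (shift 0)))) \<le> 3"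
      using strip_sum_in_core[OF fresh_0 w]
        norm_triangle_ineq2[of "of_real (1/8) * exp (exp w)" "cnj (u 0) * strip_sum (u 0 * (w + of_real (shift 0)))"]
      by (simp add: norm_minus_commute)
    then show "1/8 * exp (Re (exp w)) - 3 \<le> norm (strip_sum (cis \<theta> * (w + of_real (shift 0))))"
      by (simp add: norm_mult u0)
  qed (auto simp: \<theta>_def Arg2pi_ge_0 Arg2pi_lt_2pi strip_sum_holomorphic)
qed

text \<open>
  Fixed points far out in a strip have almost the direction of its axis, and the axes approximate
  every direction in \<open>E\<close>.
\<close>

lemma Julia_limiting_directions_strip_sum:
  assumes E: "E \<subseteq> {0..<2*pi}" and cpt: "compact (cis ` E)" and range: "range u \<subseteq> cis ` E"
    and dense: "\<And>x e. x \<in> cis ` E \<Longrightarrow> e > 0 \<Longrightarrow> \<exists>k. dist (u k) x < e"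
  shows "Julia_limiting_directions strip_sum = E"
proof (rule Julia_limiting_directions_eqI[OF E cpt])
  show "\<exists>v\<in>cis ` E. \<exists>a\<ge>0. norm (z - of_real a * v) \<le> pi + 2" if "z \<in> Julia_set strip_sum" for z
    using Julia_set_near_rays[OF that] range by blast
next
  fix \<theta> n assume \<theta>: "\<theta> \<in> E"
  define e where "e = 1 / (2 * real (Suc n))"
  have e: "e > 0" by (simp add: e_def)
  obtain k where k: "dist (u k) (cis \<theta>) < e" using dense \<theta> e by blast
  obtain j where j: "fresh j" "u j = u k" using ex_fresh by blast
  obtain z where z: "z \<in> Julia_set strip_sum" "z \<in> strip j" "norm z > max (real n) (2 * (pi + 1) / e)"
    using repelling_fixed_points_in_strip[OF j(1)] by blast
  have zpos: "norm z > 0" using z(3) by linarith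
  have "norm (sgn z - u j) \<le> 2 * (pi + 1) / norm z"
    using z(2) shift_ge[of j] zpos
    by (intro sgn_close_to_direction[OF near_ray_of_strip[OF z(2)] _ norm_u]) (auto simp: strip_def)
  also have "\<dots> \<le> e"
    using z(3) zpos e by (simp add: field_simps)
  finally have "norm (sgn z - cis \<theta>) \<le> e + e"
    using k norm_triangle_ineq[of "sgn z - u j" "u j - cis \<theta>"] by (simp add: j(2) dist_norm)
  also have "e + e = 1 / real (Suc n)" by (simp add: e_def del: of_nat_Suc)
  finally show "\<exists>z\<in>Julia_set strip_sum. norm z > real n \<and> norm (sgn z - cis \<theta>) \<le> 1 / real (Suc n)"
    using z by auto
qed

end

section \<open>Superposition of poles in prescribed directions\<close>

text \<open>
  The multiplicities stay free parameters: they tune the order, while the limiting directions do not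
  depend on them.
\<close>

locale pole_sequence = direction_sequence +
  fixes mult :: "nat \<Rightarrow> nat"
  assumes mult_pos: "mult k > 0"
begin

definition radius :: "nat \<Rightarrow> real" where
  "radius k = 2 ^ (k + 2)"

definition pole_at :: "nat \<Rightarrow> complex" where
  "pole_at k = of_real (radius k) * u k"

text \<open>
  The numerator makes the term at most \<open>(1/2) ^ Suc k\<close> at distance \<open>1\<close> or
  more from the pole, whatever the multiplicity.
\<close>

definition pole_term :: "nat \<Rightarrow> complex \<Rightarrow> complex" where
  "pole_term k z = (of_real ((1/2) ^ Suc k) / (z - pole_at k)) ^ mult k"

text \<open>
  Restricting to an index set allows the term of a single pole to be split off.
\<close>

definition partial_pole_sum :: "nat set \<Rightarrow> complex \<Rightarrow> complex" where
  "partial_pole_sum J z = (\<Sum>k. if k \<in> J then pole_term k z else 0)"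

text \<open>
  The value \<open>0\<close> at the poles is the one that
  \<^const>\<open>nicely_meromorphic_on\<close> requires.
\<close>

definition pole_sum :: "complex \<Rightarrow> complex" where
  "pole_sum z = (if z \<in> range pole_at then 0 else partial_pole_sum UNIV z)"

lemma norm_pole_at: "norm (pole_at k) = radius k"
  by (simp add: pole_at_def radius_def norm_mult norm_power norm_u del: of_real_power)

lemma radius_ge: "radius k \<ge> real k + 4"
proof (induction k)
  case 0
  show ?case by (simp add: radius_def)
next
  case (Suc k)
  have "radius (Suc k) = 2 * radius k" by (simp add: radius_def)
  with Suc show ?case by simp
qed

lemma radius_separated:
  assumes "j \<noteq> k"
  shows "\<bar>radius j - radius k\<bar> \<ge> 4"
proof -
  have "radius k - radius j \<ge> 4" if "j < k" for j k
  proof -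
    have "radius (Suc j) \<le> radius k"
      unfolding radius_def using that by (intro power_increasing) auto
    moreover have "radius (Suc j) = 2 * radius j" by (simp add: radius_def)
    ultimately show ?thesis using radius_ge[of j] by simp
  qed
  from this[of j k] this[of k j] assms show ?thesis by (cases "j < k") auto
qed

lemma pole_at_separated:
  assumes "j \<noteq> k"
  shows "norm (pole_at j - pole_at k) \<ge> 4"
  using radius_separated[OF assms] norm_triangle_ineq3[of "pole_at j" "pole_at k"]
  by (simp add: norm_pole_at)

lemma inj_pole_at: "inj pole_at"
proof (rule injI, rule ccontr)
  fix j k assume "pole_at j = pole_at k" "j \<noteq> k"
  then show False using pole_at_separated[of j k] by simp
qed

lemma closed_pole_set: "closed (pole_at ` J)"
proof (rule discrete_imp_closed[of 4])
  have "pole_at j = pole_at k" if "dist (pole_at j) (pole_at k) < 4" for j k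
    using pole_at_separated[of j k] that by (cases "j = k") (auto simp: dist_norm)
  then show "\<forall>x\<in>pole_at ` J. \<forall>y\<in>pole_at ` J. dist y x < 4 \<longrightarrow> y = x"
    by blast
qed simp

lemma pole_term_bound:
  assumes "norm (z - pole_at k) \<ge> 1"
  shows "norm (pole_term k z) \<le> (1/2) ^ Suc k"
proof -
  define q where "q = norm (of_real ((1/2) ^ Suc k) / (z - pole_at k))"
  have "(1/2::real) ^ Suc k / norm (z - pole_at k) \<le> (1/2) ^ Suc k / 1"
    by (intro divide_left_mono) (use assms in \<open>auto intro: mult_pos_pos less_le_trans[OF zero_less_one]\<close>)
  moreover have "norm (of_real ((1/2) ^ Suc k) :: complex) = (1/2) ^ Suc k"
    unfolding norm_of_real by simp
  ultimately have q: "q \<le> (1/2) ^ Suc k" unfolding q_def norm_divide by simp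
  moreover have "(1/2::real) ^ Suc k \<le> 1" by (rule power_le_one) auto
  ultimately have "q ^ mult k \<le> q ^ 1"
    by (intro power_decreasing) (use mult_pos[of k] in \<open>auto simp: q_def Suc_le_eq\<close>)
  then show ?thesis using q by (simp add: pole_term_def norm_power q_def)
qed

lemma pole_term_eventually_bound:
  "\<exists>N. \<forall>k\<ge>N. \<forall>z\<in>S. norm z \<le> R \<longrightarrow> norm (if k \<in> J then pole_term k z else 0) \<le> (1/2) ^ Suc k"
proof -
  obtain N where N: "real N \<ge> R" using real_arch_simple by blast
  have "norm (if k \<in> J then pole_term k z else 0) \<le> (1/2) ^ Suc k" if "k \<ge> N" "norm z \<le> R" for k z
  proof -
    have "1 \<le> radius k - norm z" using that N radius_ge[of k] by linarith
    also have "\<dots> \<le> norm (z - pole_at k)"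
      using norm_triangle_ineq2[of "pole_at k" z] by (simp add: norm_pole_at norm_minus_commute)
    finally show ?thesis using pole_term_bound[of z k] by simp
  qed
  then show ?thesis by blast
qed

lemma pole_term_summable: "summable (\<lambda>k. if k \<in> J then pole_term k z else 0)"
proof -
  obtain N where "\<forall>k\<ge>N. norm (if k \<in> J then pole_term k z else 0) \<le> (1/2) ^ Suc k"
    using pole_term_eventually_bound[of UNIV "norm z"] by blast
  then show ?thesis
    by (intro summable_comparison_test[OF _ summable_weights]) blast
qed

lemma partial_pole_sum_holomorphic:
  assumes "S \<inter> pole_at ` J = {}"
  shows "partial_pole_sum J holomorphic_on S"
proof -
  have "(\<lambda>z. \<Sum>k. if k \<in> J then pole_term k z else 0) holomorphic_on - (pole_at ` J)"
  proof (rule holomorphic_on_suminf[OF _ _ summable_weights pole_term_eventually_bound])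
    show "open (- (pole_at ` J))" using closed_pole_set by (rule open_Compl)
    show "(\<lambda>z. if k \<in> J then pole_term k z else 0) holomorphic_on - (pole_at ` J)" for k
    proof (cases "k \<in> J")
      case True
      then show ?thesis unfolding pole_term_def by (auto intro!: holomorphic_intros)
    qed simp
  qed
  then show ?thesis unfolding partial_pole_sum_def
    by (rule holomorphic_on_subset) (use assms in auto)
qed

lemma partial_pole_sum_bound:
  assumes "\<And>k. k \<in> J \<Longrightarrow> norm (z - pole_at k) \<ge> 1"
  shows "norm (partial_pole_sum J z) \<le> 1"
proof -
  have "norm (partial_pole_sum J z) \<le> (\<Sum>k. (1/2::real) ^ Suc k)"
    unfolding partial_pole_sum_def
    by (intro norm_suminf_le summable_weights) (use assms pole_term_bound in auto)
  also have "\<dots> = 1" using power_half_series by (rule sums_unique[symmetric])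
  finally show ?thesis .
qed

lemma partial_pole_sum_split:
  "partial_pole_sum UNIV z = pole_term k z + partial_pole_sum (- {k}) z"
proof -
  have "(\<lambda>j. if j = k then pole_term j z else 0) sums pole_term k z"
    by (rule sums_single)
  moreover have "(\<lambda>j. if j \<in> - {k} then pole_term j z else 0) sums partial_pole_sum (- {k}) z"
    unfolding partial_pole_sum_def by (rule summable_sums[OF pole_term_summable])
  ultimately have "(\<lambda>j. (if j = k then pole_term j z else 0) + (if j \<in> - {k} then pole_term j z else 0))
      sums (pole_term k z + partial_pole_sum (- {k}) z)" by (rule sums_add)
  moreover have "(\<lambda>j. (if j = k then pole_term j z else 0) + (if j \<in> - {k} then pole_term j z else 0)) =
      (\<lambda>j. if j \<in> UNIV then pole_term j z else 0)" by auto
  ultimately show ?thesis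
    unfolding partial_pole_sum_def[of UNIV] by (simp add: sums_iff)
qed

lemma pole_sum_holomorphic:
  assumes "S \<inter> range pole_at = {}"
  shows "pole_sum holomorphic_on S"
proof (rule holomorphic_transform)
  show "partial_pole_sum UNIV holomorphic_on S" by (rule partial_pole_sum_holomorphic[OF assms])
qed (use assms in \<open>auto simp: pole_sum_def\<close>)

lemma pole_sum_bound_outside:
  assumes "\<And>k. norm (z - pole_at k) \<ge> 1"
  shows "norm (pole_sum z) \<le> 1"
  using partial_pole_sum_bound[of UNIV z] assms by (simp add: pole_sum_def)

lemma far_from_other_poles:
  assumes "norm (z - pole_at k) \<le> 3" "j \<noteq> k"
  shows "norm (z - pole_at j) \<ge> 1"
  using pole_at_separated[OF assms(2)] assms(1) norm_triangle_ineq[of "pole_at j - z" "z - pole_at k"]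
  by (simp add: norm_minus_commute)

text \<open>
  The pole sum multiplied by \<open>(z - pole_at k) ^ mult k\<close>, which is holomorphic near the
  \<open>k\<close>-th pole.
\<close>

definition pole_factor :: "nat \<Rightarrow> complex \<Rightarrow> complex" where
  "pole_factor k z =
     of_real ((1/2) ^ Suc k) ^ mult k + partial_pole_sum (- {k}) z * (z - pole_at k) ^ mult k"

lemma pole_factor_holomorphic: "pole_factor k holomorphic_on ball (pole_at k) 3"
proof -
  have "ball (pole_at k) 3 \<inter> pole_at ` (- {k}) = {}"
  proof -
    have "pole_at j \<notin> ball (pole_at k) 3" if "j \<noteq> k" for j
      using pole_at_separated[OF that] by (simp add: dist_norm norm_minus_commute)
    then show ?thesis by blast
  qed
  then have "partial_pole_sum (- {k}) holomorphic_on ball (pole_at k) 3"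
    by (rule partial_pole_sum_holomorphic)
  then show ?thesis unfolding pole_factor_def by (intro holomorphic_intros)
qed

lemma pole_factor_nonzero: "pole_factor k (pole_at k) \<noteq> 0"
  using mult_pos[of k] by (simp add: pole_factor_def power_0_left)

lemma pole_sum_near_pole:
  assumes "z \<in> ball (pole_at k) 3" "z \<noteq> pole_at k"
  shows "pole_sum z = pole_factor k z / (z - pole_at k) ^ mult k"
proof -
  have "z \<noteq> pole_at j" for j
  proof (cases "j = k")
    case False
    then show ?thesis
      using far_from_other_poles[of z k j] assms by (auto simp: dist_norm norm_minus_commute)
  qed (use assms in auto)
  then have "pole_sum z = partial_pole_sum UNIV z" by (auto simp: pole_sum_def)
  also have "\<dots> = pole_term k z + partial_pole_sum (- {k}) z" by (rule partial_pole_sum_split)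
  also have "\<dots> = pole_factor k z / (z - pole_at k) ^ mult k"
  proof -
    have "(e / w) ^ m + s = (e ^ m + s * w ^ m) / w ^ m" if "w \<noteq> 0" for e w s :: complex and m
      using that by (simp add: power_divide add_divide_distrib)
    then show ?thesis
      unfolding pole_factor_def pole_term_def using assms(2) by (metis right_minus_eq)
  qed
  finally show ?thesis .
qed

lemma eventually_pole_sum_near_pole:
  "\<forall>\<^sub>F z in at (pole_at k). pole_sum z = pole_factor k z / (z - pole_at k) ^ mult k"
  unfolding eventually_at
  by (intro exI[of _ 3]) (auto intro!: pole_sum_near_pole simp: dist_commute)

lemma is_pole_pole_sum_iff: "is_pole pole_sum z \<longleftrightarrow> z \<in> range pole_at"
proof
  assume "is_pole pole_sum z"
  then show "z \<in> range pole_at"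
    using not_is_pole_holomorphic[of "- range pole_at" z pole_sum] closed_pole_set[of UNIV]
      pole_sum_holomorphic[of "- range pole_at"] by auto
next
  assume "z \<in> range pole_at"
  then obtain k where z: "z = pole_at k" by blast
  have "is_pole (\<lambda>w. pole_factor k w / (w - pole_at k) ^ mult k) (pole_at k)"
    by (rule is_pole_basic[OF pole_factor_holomorphic _ _ pole_factor_nonzero mult_pos]) auto
  then show "is_pole pole_sum z"
    unfolding z using is_pole_cong[OF eventually_pole_sum_near_pole[of k] refl] by simp
qed

lemma zorder_pole_sum: "zorder pole_sum (pole_at k) = - int (mult k)"
proof (rule zorder_eqI[OF _ _ pole_factor_holomorphic pole_factor_nonzero])
  show "pole_sum w = pole_factor k w * (w - pole_at k) powi - int (mult k)"
    if "w \<in> ball (pole_at k) 3" "w \<noteq> pole_at k" for w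
    using pole_sum_near_pole[OF that] by (simp add: power_int_minus divide_inverse)
qed auto

lemma pole_sum_nicely_meromorphic: "pole_sum nicely_meromorphic_on UNIV"
proof -
  have ana: "pole_sum analytic_on {z}" if "z \<notin> range pole_at" for z
    unfolding analytic_at
    by (intro exI[of _ "- range pole_at"] conjI pole_sum_holomorphic)
       (use that closed_pole_set[of UNIV] in auto)
  have "pole_sum meromorphic_on {z}" for z
  proof (cases "z \<in> range pole_at")
    case True
    then obtain k where z: "z = pole_at k" by blast
    have "pole_factor k analytic_on {z}"
      unfolding analytic_at z by (intro exI[of _ "ball (pole_at k) 3"] conjI pole_factor_holomorphic) auto
    then have "(\<lambda>w. pole_factor k w / (w - pole_at k) ^ mult k) meromorphic_on {z}"
      by (intro meromorphic_intros analytic_on_imp_meromorphic_on)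
    moreover have "pole_sum meromorphic_on {z} \<longleftrightarrow>
        (\<lambda>w. pole_factor k w / (w - pole_at k) ^ mult k) meromorphic_on {z}"
      by (rule meromorphic_on_cong) (use eventually_pole_sum_near_pole[of k] z in auto)
    ultimately show ?thesis by simp
  next
    case False
    then show ?thesis by (intro analytic_on_imp_meromorphic_on ana)
  qed
  then have "pole_sum meromorphic_on UNIV"
    by (subst meromorphic_on_meromorphic_at) simp
  moreover have "(is_pole pole_sum z \<and> pole_sum z = 0) \<or> pole_sum \<midarrow>z\<rightarrow> pole_sum z" for z
  proof (cases "z \<in> range pole_at")
    case True
    then show ?thesis using is_pole_pole_sum_iff[of z] by (simp add: pole_sum_def)
  next
    case False
    then show ?thesis using ana analytic_at_imp_isCont isContD by blast
  qed
  ultimately show ?thesis unfolding nicely_meromorphic_on_def by blast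
qed

text \<open>
  A quotient of polynomials has only finitely many poles.
\<close>

lemma pole_sum_transcendental: "transcendental_meromorphic pole_sum"
proof -
  have "\<not> (\<exists>p q. q \<noteq> 0 \<and> (\<forall>z. poly q z \<noteq> 0 \<longrightarrow> pole_sum z = poly p z / poly q z))"
  proof
    assume "\<exists>p q. q \<noteq> 0 \<and> (\<forall>z. poly q z \<noteq> 0 \<longrightarrow> pole_sum z = poly p z / poly q z)"
    then obtain p q where q: "q \<noteq> 0" and pq: "\<And>z. poly q z \<noteq> 0 \<Longrightarrow> pole_sum z = poly p z / poly q z"
      by blast
    have fin: "finite {z. poly q z = 0}" by (rule poly_roots_finite[OF q])
    have "range pole_at \<subseteq> {z. poly q z = 0}"
    proof (rule ccontr)
      assume "\<not> range pole_at \<subseteq> {z. poly q z = 0}"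
      then obtain k where k: "poly q (pole_at k) \<noteq> 0" by auto
      have "pole_sum holomorphic_on - {z. poly q z = 0}"
        by (rule holomorphic_transform[of "\<lambda>z. poly p z / poly q z"])
           (auto intro!: holomorphic_intros simp: pq)
      then have "\<not> is_pole pole_sum (pole_at k)"
        by (rule not_is_pole_holomorphic[rotated 2])
           (use k fin in \<open>auto intro: open_Compl finite_imp_closed\<close>)
      then show False by (simp add: is_pole_pole_sum_iff)
    qed
    then have "finite (range pole_at)" using fin finite_subset by blast
    then show False using inj_pole_at finite_imageD infinite_UNIV_nat by blast
  qed
  then show ?thesis
    unfolding transcendental_meromorphic_def
    using pole_sum_nicely_meromorphic is_pole_pole_sum_iff by blast
qed

lemma Julia_set_pole_sum_near_poles:
  assumes "z \<in> Julia_set pole_sum"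
  shows "\<exists>k. norm (z - pole_at k) \<le> 2"
proof -
  define X where "X = {w. \<forall>k. norm (w - pole_at k) \<ge> 1}"
  have "pole_at k \<notin> X" for k by (auto simp: X_def intro!: exI[of _ k])
  then have disj: "X \<inter> range pole_at = {}" by blast
  have "\<not> ball z 1 \<subseteq> X"
  proof
    assume "ball z 1 \<subseteq> X"
    then have "z \<in> Fatou_set pole_sum"
    proof (rule trapped_in_Fatou_set[rotated -1])
      show "pole_sum holomorphic_on X" by (rule pole_sum_holomorphic[OF disj])
      show "norm (pole_sum w) \<le> 1" if "w \<in> X" for w
        using that by (intro pole_sum_bound_outside) (auto simp: X_def)
      have "norm (w - pole_at k) \<ge> 1" if "norm w \<le> 1" for w k
        using that norm_triangle_ineq2[of "pole_at k" w] radius_ge[of k]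
        by (simp add: norm_pole_at norm_minus_commute)
      then show "cball 0 1 \<subseteq> X" by (auto simp: X_def)
      show "\<not> is_pole pole_sum w" if "w \<in> X" for w
        using that disj by (auto simp: is_pole_pole_sum_iff)
    qed
    with assms show False by (simp add: Julia_set_def)
  qed
  then obtain y where "y \<in> ball z 1" "y \<notin> X" by blast
  then obtain k where y: "norm (z - y) < 1" "norm (y - pole_at k) < 1"
    unfolding X_def by (auto simp: dist_norm not_le)
  then have "norm (z - pole_at k) \<le> 2"
    using norm_triangle_ineq[of "z - y" "y - pole_at k"] by simp
  then show ?thesis by blast
qed

text \<open>
  The poles themselves are the Julia points that realise the directions.
\<close>

lemma Julia_limiting_directions_pole_sum:
  assumes E: "E \<subseteq> {0..<2*pi}" and cpt: "compact (cis ` E)" and range: "range u \<subseteq> cis ` E"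
    and dense: "\<And>x e n. x \<in> cis ` E \<Longrightarrow> e > 0 \<Longrightarrow> \<exists>k\<ge>n. dist (u k) x < e"
  shows "Julia_limiting_directions pole_sum = E"
proof (rule Julia_limiting_directions_eqI[OF E cpt])
  fix z assume "z \<in> Julia_set pole_sum"
  then obtain k where "norm (z - of_real (radius k) * u k) \<le> 2"
    using Julia_set_pole_sum_near_poles by (auto simp: pole_at_def)
  moreover have "radius k \<ge> 0" by (simp add: radius_def)
  ultimately show "\<exists>v\<in>cis ` E. \<exists>a\<ge>0. norm (z - of_real a * v) \<le> 2"
    using range by blast
next
  fix \<theta> n assume \<theta>: "\<theta> \<in> E"
  then obtain k where k: "k \<ge> n" "dist (u k) (cis \<theta>) < 1 / real (Suc n)"
    using dense[of "cis \<theta>" "1 / real (Suc n)" n] by auto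
  have "pole_at k \<in> Julia_set pole_sum"
    by (rule pole_in_Julia_set) (simp add: is_pole_pole_sum_iff)
  moreover have "norm (pole_at k) > real n" using radius_ge[of k] k by (simp add: norm_pole_at)
  moreover have "sgn (pole_at k) = u k"
    using norm_pole_at[of k] by (simp add: sgn_eq) (simp add: pole_at_def radius_def)
  ultimately show "\<exists>z\<in>Julia_set pole_sum. norm z > real n \<and> norm (sgn z - cis \<theta>) \<le> 1 / real (Suc n)"
    using k(2) by (intro bexI[of _ "pole_at k"]) (auto simp: dist_norm)
qed

end

section \<open>Proximity and counting function of the pole sum\<close>

text \<open>
  A weak form of Jordan's inequality: up to \<open>pi / 3\<close> by comparing derivatives, then by
  monotonicity.
\<close>

lemma sin_ge_quarter:
  assumes "0 \<le> y" "y \<le> pi / 2"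
  shows "y / 4 \<le> sin y"
proof (cases "y \<le> pi / 3")
  case True
  have "sin 0 - 0 / 4 \<le> sin y - y / 4"
  proof (rule DERIV_nonneg_imp_nondecreasing[of 0 y "\<lambda>x. sin x - x / 4"])
    fix x assume x: "0 \<le> x" "x \<le> y"
    have "cos (pi / 3) \<le> cos x" using x True by (intro cos_monotone_0_pi_le) auto
    then have "0 \<le> cos x - 1 / 4" by (simp add: cos_60)
    moreover have "((\<lambda>x. sin x - x / 4) has_real_derivative cos x - 1 / 4) (at x)"
      by (auto intro!: derivative_eq_intros)
    ultimately show "\<exists>D. ((\<lambda>x. sin x - x / 4) has_real_derivative D) (at x) \<and> D \<ge> 0" by blast
  qed fact
  then show ?thesis by simp
next
  case False
  have "1 / 2 \<le> sqrt 3 / 2" by simp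
  also have "\<dots> = sin (pi / 3)" by (simp add: sin_60)
  also have "\<dots> \<le> sin y" using assms False by (intro sin_monotone_2pi_le) auto
  finally show ?thesis using assms pi_less_4 by linarith
qed

lemma norm_cis_diff: "norm (cis a - cis b) = 2 * \<bar>sin ((a - b) / 2)\<bar>"
proof -
  define s h where "s = (a + b) / 2" and "h = (a - b) / 2"
  have e: "(b - a) / 2 = - h" by (simp add: h_def field_simps)
  have "cos a - cos b = - (2 * sin s * sin h)" "sin a - sin b = 2 * sin h * cos s"
    using cos_diff_cos[of a b] sin_diff_sin[of a b]
    unfolding e s_def[symmetric] h_def[symmetric] by simp_all
  then have "cis a - cis b = cis s * (2 * \<i> * of_real (sin h))"
    by (simp add: complex_eq_iff)
  then have "norm (cis a - cis b) = norm (cis s * (2 * \<i> * of_real (sin h)))" by simp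
  then show ?thesis by (simp add: norm_mult h_def)
qed

text \<open>
  The three candidates are the lifts of \<open>b\<close> that can be nearest to \<open>a\<close>, so
  that the singularity of \<open>1 / \<bar>cis a - cis b\<bar>\<close> is compared with a
  singularity on the line.
\<close>

lemma norm_cis_diff_ge:
  assumes "\<bar>a - b\<bar> \<le> 2 * pi"
  shows "\<exists>c\<in>{b, b + 2 * pi, b - 2 * pi}. norm (cis a - cis b) \<ge> \<bar>a - c\<bar> / 4"
proof -
  consider "\<bar>a - b\<bar> \<le> pi" | "a - b > pi" | "b - a > pi" by linarith
  then show ?thesis
  proof cases
    case 1
    have "\<bar>a - b\<bar> / 2 / 4 \<le> sin (\<bar>a - b\<bar> / 2)" using 1 by (intro sin_ge_quarter) auto
    also have "\<dots> \<le> \<bar>sin ((a - b) / 2)\<bar>"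
    proof (cases "a \<ge> b")
      case False
      then have "\<bar>a - b\<bar> / 2 = - ((a - b) / 2)" by (simp add: field_simps)
      then show ?thesis by (simp only: sin_minus)
    qed simp
    finally show ?thesis by (simp add: norm_cis_diff)
  next
    case 2
    have "(pi - (a - b) / 2) / 4 \<le> sin (pi - (a - b) / 2)" using 2 assms by (intro sin_ge_quarter) auto
    also have "\<dots> = sin ((a - b) / 2)" by simp
    finally have "2 * ((pi - (a - b) / 2) / 4) \<le> 2 * \<bar>sin ((a - b) / 2)\<bar>"
      using order_trans[OF _ abs_ge_self] by (intro mult_left_mono) auto
    then have "(2 * pi - (a - b)) / 4 \<le> 2 * \<bar>sin ((a - b) / 2)\<bar>" by (simp add: field_simps)
    then show ?thesis using 2 assms by (auto simp: norm_cis_diff abs_if)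
  next
    case 3
    have "(pi - (b - a) / 2) / 4 \<le> sin (pi - (b - a) / 2)" using 3 assms by (intro sin_ge_quarter) auto
    also have "\<dots> = sin ((b - a) / 2)" by simp
    finally have "2 * ((pi - (b - a) / 2) / 4) \<le> 2 * \<bar>sin ((b - a) / 2)\<bar>"
      using order_trans[OF _ abs_ge_self] by (intro mult_left_mono) auto
    then have "(2 * pi - (b - a)) / 4 \<le> norm (cis b - cis a)"
      by (simp add: norm_cis_diff field_simps)
    then show ?thesis using 3 assms by (auto simp: norm_minus_commute abs_if)
  qed
qed

text \<open>
  The nearest-point projection onto the unit disc does not increase distances.
\<close>

lemma norm_diff_le_of_scaled:
  fixes x y :: complex
  assumes "r \<ge> 1" "s \<ge> 1" "norm x = 1" "norm y = 1"
  shows "norm (x - y) \<le> norm (of_real r * x - of_real s * y)"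
proof (rule power2_le_imp_le)
  define c where "c = x \<bullet> y"
  have "c \<le> 1" using norm_cauchy_schwarz[of x y] assms by (simp add: c_def)
  then have "(r * s - 1) * c \<le> (r * s - 1) * 1"
    using mult_mono[of 1 r 1 s] assms by (intro mult_left_mono) auto
  moreover have "0 \<le> (r - s)\<^sup>2" by simp
  ultimately have "2 - 2 * c \<le> r\<^sup>2 + s\<^sup>2 - 2 * (r * s) * c"
    by (simp add: power2_diff algebra_simps)
  moreover have "(norm (x - y))\<^sup>2 = 2 - 2 * c"
    using assms by (simp add: power2_norm_eq_inner inner_diff inner_commute c_def norm_eq_1)
  moreover have e: "of_real r * x - of_real s * y = r *\<^sub>R x - s *\<^sub>R y"
    by (simp add: scaleR_conv_of_real)
  have "(norm (of_real r * x - of_real s * y))\<^sup>2 = r\<^sup>2 + s\<^sup>2 - 2 * (r * s) * c"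
    unfolding e power2_norm_eq_inner using assms by (simp add: inner_diff inner_commute c_def norm_eq_1 power2_eq_square)
  ultimately show "(norm (x - y))\<^sup>2 \<le> (norm (of_real r * x - of_real s * y))\<^sup>2"
    by linarith
qed simp

text \<open>
  The antiderivative \<open>2 * sqrt (x - c)\<close> is valid on both sides of \<open>c\<close>
  because the real square root of a negative number is \<open>sqrt (- t) = - sqrt t\<close>.
\<close>

lemma inverse_sqrt_has_integral:
  assumes "a \<le> b"
  shows "((\<lambda>x. 1 / sqrt \<bar>x - c\<bar>) has_integral 2 * sqrt (b - c) - 2 * sqrt (a - c)) {a..b}"
proof (rule fundamental_theorem_of_calculus_interior_strong[of "{c}"])
  show "continuous_on {a..b} (\<lambda>x. 2 * sqrt (x - c))" by (intro continuous_intros)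
  fix x assume "x \<in> {a<..<b} - {c}"
  then have x: "x - c \<noteq> 0" by simp
  have "((\<lambda>x. sqrt (x - c)) has_real_derivative (1 / (2 * sqrt \<bar>x - c\<bar>)) * 1) (at x)"
  proof (rule DERIV_chain2[where f = sqrt])
    show "(sqrt has_real_derivative 1 / (2 * sqrt \<bar>x - c\<bar>)) (at (x - c))"
      by (rule DERIV_real_sqrt_generic[OF x])
         (use x in \<open>auto simp: field_simps real_sqrt_minus[symmetric]\<close>)
    show "((\<lambda>x. x - c) has_real_derivative 1) (at x)" by (auto intro!: derivative_eq_intros)
  qed
  then have "((\<lambda>x. 2 * sqrt (x - c)) has_real_derivative 2 * (1 / (2 * sqrt \<bar>x - c\<bar>) * 1)) (at x)"
    by (rule DERIV_cmult)
  then show "((\<lambda>x. 2 * sqrt (x - c)) has_vector_derivative 1 / sqrt \<bar>x - c\<bar>) (at x)"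
    by (simp add: has_real_derivative_iff_has_vector_derivative)
qed (use assms in auto)

text \<open>
  A non-integrable function has integral \<open>0\<close>, so an upper bound with \<open>I \<ge>
  0\<close> needs only the comparison.
\<close>

lemma integral_le_off_finite:
  fixes g :: "real \<Rightarrow> real"
  assumes H: "(H has_integral I) {a..b}" and S: "finite S"
    and le: "\<And>x. x \<in> {a..b} - S \<Longrightarrow> g x \<le> H x" and "0 \<le> I"
  shows "integral {a..b} g \<le> I"
proof (cases "g integrable_on {a..b}")
  case True
  have "((\<lambda>x. if x \<in> S then g x else H x) has_integral I) {a..b}"
    by (rule has_integral_spike_finite[OF S _ H]) auto
  from has_integral_le[OF integrable_integral[OF True] this] le show ?thesis by auto
qed (use \<open>0 \<le> I\<close> in \<open>simp add: not_integrable_integral\<close>)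

lemma log_plus_le_sqrt:
  assumes "x \<ge> 0"
  shows "log_plus x \<le> 2 * sqrt x"
proof (cases "x \<ge> 1")
  case True
  have "ln x = 2 * ln (sqrt x)" using True by (simp add: ln_sqrt)
  also have "\<dots> \<le> 2 * (sqrt x - 1)" using True by (intro mult_left_mono ln_le_minus_one) auto
  finally show ?thesis using True by (simp add: log_plus_eq max_def)
qed (use assms in \<open>simp add: log_plus_eq max_def\<close>)

lemma log_plus_add_one: "x \<ge> 0 \<Longrightarrow> log_plus (x + 1) \<le> log_plus x + ln 2"
proof -
  assume x: "x \<ge> 0"
  have "ln (x + 1) \<le> ln (max x 1 * 2)" using x by (subst ln_le_cancel_iff) (auto simp: max_def)
  also have "\<dots> = ln (max x 1) + ln 2" by (subst ln_mult) (auto simp: max_def)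
  finally show ?thesis using x by (simp add: log_plus_eq max_def)
qed

lemma log_plus_power: "x \<ge> 0 \<Longrightarrow> log_plus (x ^ m) = real m * log_plus x"
proof -
  assume x: "x \<ge> 0"
  have "max (x ^ m) 1 = max x 1 ^ m"
  proof (cases "x \<ge> 1")
    case True
    then show ?thesis using one_le_power[OF True, of m] by (simp add: max_absorb1)
  next
    case False
    then show ?thesis using power_le_one[OF x, of m] by (auto simp: max_def)
  qed
  then show ?thesis using x by (simp add: log_plus_eq ln_realpow max_def)
qed

text \<open>
  The logarithmic singularity is dominated by an inverse square root, uniformly in the radii. The
  three summands stand for the three lifts of the direction \<open>\<theta>\<close>.
\<close>

lemma log_plus_inverse_distance:
  assumes r: "r \<ge> 1" "s \<ge> 1" and \<phi>: "\<bar>\<phi> - \<theta>\<bar> \<le> 2 * pi"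
    and off: "\<phi> \<notin> {\<theta>, \<theta> + 2 * pi, \<theta> - 2 * pi}"
  shows "log_plus (1 / norm (of_real r * cis \<phi> - of_real s * cis \<theta>)) \<le>
    4 * (1 / sqrt \<bar>\<phi> - \<theta>\<bar> + 1 / sqrt \<bar>\<phi> - (\<theta> + 2 * pi)\<bar> + 1 / sqrt \<bar>\<phi> - (\<theta> - 2 * pi)\<bar>)"
proof -
  obtain c where c: "c \<in> {\<theta>, \<theta> + 2 * pi, \<theta> - 2 * pi}" "norm (cis \<phi> - cis \<theta>) \<ge> \<bar>\<phi> - c\<bar> / 4"
    using norm_cis_diff_ge[OF \<phi>] by blast
  have pos: "\<bar>\<phi> - c\<bar> > 0" using c off by auto
  have "\<bar>\<phi> - c\<bar> / 4 \<le> norm (of_real r * cis \<phi> - of_real s * cis \<theta>)"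
    using c(2) norm_diff_le_of_scaled[OF r, of "cis \<phi>" "cis \<theta>"] by simp
  then have "1 / norm (of_real r * cis \<phi> - of_real s * cis \<theta>) \<le> 1 / (\<bar>\<phi> - c\<bar> / 4)"
    using pos by (intro divide_left_mono mult_pos_pos) auto
  then have "log_plus (1 / norm (of_real r * cis \<phi> - of_real s * cis \<theta>)) \<le> log_plus (1 / (\<bar>\<phi> - c\<bar> / 4))"
    by (intro log_plus_mono) auto
  also have "\<dots> \<le> 2 * sqrt (1 / (\<bar>\<phi> - c\<bar> / 4))" by (intro log_plus_le_sqrt) auto
  also have "\<dots> = 4 * (1 / sqrt \<bar>\<phi> - c\<bar>)" by (simp add: real_sqrt_divide real_sqrt_mult)
  also have "\<dots> \<le> 4 * (1 / sqrt \<bar>\<phi> - \<theta>\<bar> + 1 / sqrt \<bar>\<phi> - (\<theta> + 2 * pi)\<bar> + 1 / sqrt \<bar>\<phi> - (\<theta> - 2 * pi)\<bar>)"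
  proof -
    have "4 * q \<le> 4 * (q1 + q2 + q3)"
      if "q \<in> {q1, q2, q3}" "q1 \<ge> 0" "q2 \<ge> 0" "q3 \<ge> 0" for q q1 q2 q3 :: real
      using that by auto
    from this[of "1 / sqrt \<bar>\<phi> - c\<bar>"] show ?thesis using c(1) by auto
  qed
  finally show ?thesis .
qed

context pole_sequence
begin

lemma proximity_pole_sum_eq_0:
  assumes r: "r \<ge> 0" and far: "\<And>k. \<bar>r - radius k\<bar> \<ge> 1"
  shows "proximity_fun r pole_sum = 0"
proof -
  have "log_plus (norm (pole_sum (of_real r * cis t))) = 0" for t
  proof -
    have "norm (of_real r * cis t - pole_at k) \<ge> 1" for k
      using norm_triangle_ineq3[of "of_real r * cis t" "pole_at k"] far[of k] r
      by (simp add: norm_mult norm_pole_at)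
    then have "norm (pole_sum (of_real r * cis t)) \<le> 1" by (rule pole_sum_bound_outside)
    then show ?thesis by (simp add: log_plus_eq max_def)
  qed
  then show ?thesis by (simp add: proximity_fun_def)
qed

text \<open>
  On a circle that comes within distance \<open>1\<close> of the modulus of one pole, all other
  terms together contribute at most \<open>1\<close>.
\<close>

lemma log_plus_pole_sum_le:
  assumes r: "r \<ge> 0" and near: "\<bar>r - radius k\<bar> < 1" and z: "norm z = r"
  shows "log_plus (norm (pole_sum z)) \<le> real (mult k) * log_plus (1 / norm (z - pole_at k)) + ln 2"
proof (cases "z \<in> range pole_at")
  case True
  then show ?thesis by (simp add: pole_sum_def log_plus_eq log_plus_nonneg)
next
  case False
  have "norm (z - pole_at j) \<ge> 1" if "j \<noteq> k" for j
    using norm_triangle_ineq3[of z "pole_at j"] radius_separated[OF that] near z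
    by (simp add: norm_pole_at)
  then have rest: "norm (partial_pole_sum (- {k}) z) \<le> 1"
    by (intro partial_pole_sum_bound) auto
  have "norm (pole_term k z) = (norm (of_real ((1/2) ^ Suc k) :: complex) / norm (z - pole_at k)) ^ mult k"
    by (simp only: pole_term_def norm_power norm_divide)
  also have "norm (of_real ((1/2) ^ Suc k) :: complex) = (1/2) ^ Suc k"
    unfolding norm_of_real by simp
  also have "((1/2) ^ Suc k / norm (z - pole_at k)) ^ mult k \<le> (1 / norm (z - pole_at k)) ^ mult k"
    by (intro power_mono divide_right_mono power_le_one) auto
  finally have "norm (pole_sum z) \<le> (1 / norm (z - pole_at k)) ^ mult k + 1"
    using rest norm_triangle_ineq[of "pole_term k z" "partial_pole_sum (- {k}) z"] False
    by (simp add: pole_sum_def partial_pole_sum_split[of z k])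
  then have "log_plus (norm (pole_sum z)) \<le> log_plus ((1 / norm (z - pole_at k)) ^ mult k + 1)"
    by (intro log_plus_mono) auto
  also have "\<dots> \<le> log_plus ((1 / norm (z - pole_at k)) ^ mult k) + ln 2"
    by (intro log_plus_add_one) auto
  also have "log_plus ((1 / norm (z - pole_at k)) ^ mult k) = real (mult k) * log_plus (1 / norm (z - pole_at k))"
    by (intro log_plus_power) auto
  finally show ?thesis .
qed

text \<open>
  Each of the three inverse square roots has integral at most \<open>16\<close> over a period, which
  bounds the integral by \<open>192 * mult k + 8\<close>; the constant \<open>40\<close> absorbs the
  rest because \<open>2 * pi \<ge> 5\<close> and \<open>mult k \<ge> 1\<close>.
\<close>

lemma proximity_pole_sum_le:
  assumes r: "r \<ge> 1" and near: "\<bar>r - radius k\<bar> < 1"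
  shows "proximity_fun r pole_sum \<le> 40 * real (mult k)"
proof -
  define \<theta> where "\<theta> = Arg2pi (u k)"
  have \<theta>: "0 \<le> \<theta>" "\<theta> < 2 * pi" by (auto simp: \<theta>_def Arg2pi_ge_0 Arg2pi_lt_2pi)
  have uk: "u k = cis \<theta>"
    using cis_Arg2pi_unit[OF norm_u[of k]] by (simp add: \<theta>_def)
  let ?m = "real (mult k)"
  let ?q = "\<lambda>c \<phi>. 1 / sqrt \<bar>\<phi> - c\<bar>"
  let ?Q = "\<lambda>c. 2 * sqrt (2 * pi - c) - 2 * sqrt (0 - c)"
  define I where "I = ?m * (4 * (?Q \<theta> + ?Q (\<theta> + 2 * pi) + ?Q (\<theta> - 2 * pi))) + ln 2 * (2 * pi - 0)"
  have Q: "((?q c) has_integral ?Q c) {0..2 * pi}" for c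
    by (rule inverse_sqrt_has_integral) simp
  have cnst: "((\<lambda>\<phi>. ln 2 :: real) has_integral ln 2 * (2 * pi - 0)) {0..2 * pi}"
    using has_integral_const_real[of "ln 2 :: real" 0 "2 * pi"] by (simp add: mult.commute)
  have "((\<lambda>\<phi>. ?m * (4 * (?q \<theta> \<phi> + ?q (\<theta> + 2 * pi) \<phi> + ?q (\<theta> - 2 * pi) \<phi>)) + ln 2) has_integral I) {0..2 * pi}"
    unfolding I_def by (intro has_integral_add has_integral_mult_right Q cnst)
  moreover have Qb: "?Q c \<le> 16" if "\<bar>c\<bar> \<le> 4 * pi" "\<bar>2 * pi - c\<bar> \<le> 4 * pi" for c
  proof -
    have "\<bar>sqrt t\<bar> \<le> 4" if "\<bar>t\<bar> \<le> 4 * pi" for t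
    proof -
      have "\<bar>sqrt t\<bar> = sqrt \<bar>t\<bar>" using real_sqrt_minus[of t] by (cases "t \<ge> 0") (simp_all add: abs_if)
      also have "\<dots> \<le> sqrt (4\<^sup>2)" using that pi_less_4 by (intro real_sqrt_le_mono) auto
      finally show ?thesis by simp
    qed
    from this[of "2 * pi - c"] this[of "0 - c"] that show ?thesis by (simp add: abs_le_iff)
  qed
  moreover have Qsum: "?Q \<theta> + ?Q (\<theta> + 2 * pi) + ?Q (\<theta> - 2 * pi) \<le> 48"
    using Qb[of \<theta>] Qb[of "\<theta> + 2 * pi"] Qb[of "\<theta> - 2 * pi"] \<theta> by linarith
  moreover have Qnn: "?Q c \<ge> 0" for c by simp
  moreover have I0: "0 \<le> I"
  proof -
    have "0 \<le> ?m * (4 * S) + ln 2 * (2 * pi - 0)" if "0 \<le> S" for S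
      using that by (intro add_nonneg_nonneg mult_nonneg_nonneg) auto
    then show ?thesis unfolding I_def
      using Qnn[of \<theta>] Qnn[of "\<theta> + 2 * pi"] Qnn[of "\<theta> - 2 * pi"] by (meson add_nonneg_nonneg)
  qed
  moreover have "log_plus (norm (pole_sum (of_real r * cis \<phi>))) \<le>
      ?m * (4 * (?q \<theta> \<phi> + ?q (\<theta> + 2 * pi) \<phi> + ?q (\<theta> - 2 * pi) \<phi>)) + ln 2"
    if "\<phi> \<in> {0..2 * pi} - {\<theta>, \<theta> + 2 * pi, \<theta> - 2 * pi}" for \<phi>
  proof -
    have "log_plus (norm (pole_sum (of_real r * cis \<phi>))) \<le>
        ?m * log_plus (1 / norm (of_real r * cis \<phi> - pole_at k)) + ln 2"
      using r near by (intro log_plus_pole_sum_le) (auto simp: norm_mult)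
    also have "?m * log_plus (1 / norm (of_real r * cis \<phi> - pole_at k)) \<le>
        ?m * (4 * (?q \<theta> \<phi> + ?q (\<theta> + 2 * pi) \<phi> + ?q (\<theta> - 2 * pi) \<phi>))"
      unfolding pole_at_def uk using that \<theta> r radius_ge[of k]
      by (intro mult_left_mono log_plus_inverse_distance) auto
    finally show ?thesis by simp
  qed
  ultimately have int: "integral {0..2 * pi} (\<lambda>\<phi>. log_plus (norm (pole_sum (of_real r * cis \<phi>)))) \<le> I"
    by (intro integral_le_off_finite[where S = "{\<theta>, \<theta> + 2 * pi, \<theta> - 2 * pi}"]) auto
  have "I \<le> ?m * (4 * 48) + 1 * (2 * pi)"
    unfolding I_def using Qsum ln_2_less_1 by (intro add_mono mult_left_mono mult_mono) auto
  also have "\<dots> \<le> ?m * 192 + ?m * 8"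
    using mult_pos[of k] pi_less_4 by simp
  also have "\<dots> = 40 * ?m * 5" by simp
  also have "\<dots> \<le> 40 * ?m * (2 * pi)" using pi_gt3 by (intro mult_left_mono) auto
  finally show ?thesis
    unfolding proximity_fun_def using int pi_gt_zero by (simp add: pos_divide_le_eq)
qed

lemma finite_poles_in_disc: "finite {k. radius k \<le> t}"
proof (rule finite_subset)
  show "{k. radius k \<le> t} \<subseteq> {..nat \<lceil>t\<rceil>}"
  proof
    fix k assume "k \<in> {k. radius k \<le> t}"
    then have "real k \<le> t" using radius_ge[of k] by simp
    then show "k \<in> {..nat \<lceil>t\<rceil>}" by simp linarith
  qed
qed simp

lemma pole_count_pole_sum: "pole_count t pole_sum = (\<Sum>k | radius k \<le> t. mult k)"
proof -
  have "{z. norm z \<le> t \<and> is_pole pole_sum z} = pole_at ` {k. radius k \<le> t}"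
    by (auto simp: is_pole_pole_sum_iff norm_pole_at)
  then have "pole_count t pole_sum = (\<Sum>k | radius k \<le> t. nat (- zorder pole_sum (pole_at k)))"
    unfolding pole_count_def
    by (simp add: sum.reindex[OF inj_on_subset[OF inj_pole_at]])
  then show ?thesis by (simp add: zorder_pole_sum)
qed

text \<open>
  The counting function is a step function, and the pole at distance \<open>radius k\<close>
  contributes the integral of \<open>mult k / t\<close> from \<open>radius k\<close> to
  \<open>r\<close>.
\<close>

lemma integrated_pole_count_pole_sum:
  assumes "r > 0"
  shows "integrated_pole_count r pole_sum = (\<Sum>k | radius k \<le> r. real (mult k) * ln (r / radius k))"
proof -
  let ?K = "{k. radius k \<le> r}"
  have rpos: "radius k > 0" for k by (simp add: radius_def)
  have zero: "pole_count 0 pole_sum = 0"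
    unfolding pole_count_pole_sum using rpos by (simp add: not_le[symmetric] Collect_empty_eq)
  have "((\<lambda>t. \<Sum>k\<in>?K. if t \<in> {radius k..r} then real (mult k) * (1 / t) else 0) has_integral
      (\<Sum>k\<in>?K. real (mult k) * (ln r - ln (radius k)))) {0..r}"
  proof (rule has_integral_sum[OF finite_poles_in_disc])
    fix k assume "k \<in> ?K"
    then have k: "radius k \<le> r" by simp
    have "((\<lambda>t. 1 / t) has_integral ln r - ln (radius k)) {radius k..r}"
    proof (rule fundamental_theorem_of_calculus[OF k])
      fix t assume "t \<in> {radius k..r}"
      then have "t > 0" using rpos[of k] by simp
      then show "(ln has_vector_derivative 1 / t) (at t within {radius k..r})"
        by (auto simp: has_real_derivative_iff_has_vector_derivative[symmetric] divide_inverse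
            intro!: derivative_eq_intros)
    qed
    then have "((\<lambda>t. real (mult k) * (1 / t)) has_integral real (mult k) * (ln r - ln (radius k))) {radius k..r}"
      by (rule has_integral_mult_right)
    moreover have "{radius k..r} \<subseteq> {0..r}" using rpos[of k] by auto
    ultimately show "((\<lambda>t. if t \<in> {radius k..r} then real (mult k) * (1 / t) else 0) has_integral
        real (mult k) * (ln r - ln (radius k))) {0..r}"
      by (subst has_integral_restrict) auto
  qed
  moreover have "(\<Sum>k\<in>?K. if t \<in> {radius k..r} then real (mult k) * (1 / t) else 0) =
      (real (pole_count t pole_sum) - real (pole_count 0 pole_sum)) / t" if t: "t \<in> {0..r}" for t
  proof -
    have "(\<Sum>k\<in>?K. if t \<in> {radius k..r} then real (mult k) * (1 / t) else 0) =
        (\<Sum>k\<in>{k\<in>?K. radius k \<le> t}. real (mult k) / t)"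
      using t finite_poles_in_disc[of r] by (subst sum.inter_filter) (auto intro!: sum.cong)
    also have "{k\<in>?K. radius k \<le> t} = {k. radius k \<le> t}" using t by auto
    finally show ?thesis
      unfolding zero by (simp add: pole_count_pole_sum sum_divide_distrib)
  qed
  ultimately have "((\<lambda>t. (real (pole_count t pole_sum) - real (pole_count 0 pole_sum)) / t) has_integral
      (\<Sum>k\<in>?K. real (mult k) * (ln r - ln (radius k)))) {0..r}"
    by (rule has_integral_eq[rotated])
  then have "integral {0..r} (\<lambda>t. (real (pole_count t pole_sum) - real (pole_count 0 pole_sum)) / t) =
      (\<Sum>k\<in>?K. real (mult k) * (ln r - ln (radius k)))"
    by (rule integral_unique)
  also have "\<dots> = (\<Sum>k\<in>?K. real (mult k) * ln (r / radius k))"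
    using assms rpos by (intro sum.cong) (auto simp: ln_div less_imp_neq[THEN not_sym])
  finally show ?thesis
    unfolding integrated_pole_count_def zero by simp
qed

end

section \<open>Order of the pole sum\<close>

lemma le_Limsup_of_sequence:
  fixes h :: "real \<Rightarrow> ereal"
  assumes a: "filterlim a at_top sequentially" and L: "L \<longlonglongrightarrow> l"
    and le: "\<forall>\<^sub>F k in sequentially. L k \<le> h (a k)"
  shows "l \<le> Limsup at_top h"
proof -
  have "l = Limsup sequentially L" using lim_imp_Limsup[OF _ L] by simp
  also have "\<dots> \<le> Limsup sequentially (\<lambda>k. h (a k))" by (rule Limsup_mono[OF le])
  also have "\<dots> \<le> Limsup (filtermap a sequentially) h" by (rule Limsup_filtermap_ge)
  also have "\<dots> \<le> Limsup at_top h"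
    unfolding Limsup_def using a[unfolded filterlim_def]
    by (intro INF_superset_mono order_refl) (auto simp: le_filter_def)
  finally show ?thesis .
qed

lemma proximity_nonneg: "proximity_fun r f \<ge> 0"
proof -
  let ?g = "\<lambda>t. log_plus (norm (f (of_real r * cis t)))"
  have "integral {0..2 * pi} ?g \<ge> 0"
    by (cases "?g integrable_on {0..2 * pi}")
       (auto intro!: integral_nonneg simp: log_plus_nonneg not_integrable_integral)
  then show ?thesis by (simp add: proximity_fun_def)
qed

context pole_sequence
begin

text \<open>
  At \<open>r = 2 * radius k\<close> the \<open>k\<close>-th pole alone contributes \<open>mult k *
  ln 2\<close>. As an upper limit, the order only needs this sequence of radii.
\<close>

lemma growth_order_pole_sum_ge:
  assumes "\<forall>\<^sub>F k in sequentially. radius k powr s \<le> real (mult k)"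
  shows "ereal s \<le> growth_order pole_sum"
  unfolding growth_order_def
proof (rule le_Limsup_of_sequence)
  let ?L = "\<lambda>k. (s * (real (k + 2) * ln 2) + ln (ln 2)) / (real (k + 3) * ln 2)"
  show "filterlim (\<lambda>k. 2 ^ (k + 3) :: real) at_top sequentially" by real_asymp
  have "?L \<longlonglongrightarrow> s" by real_asymp
  then show "(\<lambda>k. ereal (?L k)) \<longlonglongrightarrow> ereal s" by (rule tendsto_ereal)
  show "\<forall>\<^sub>F k in sequentially. ereal (?L k) \<le>
      ereal (log_plus (nevanlinna_char (2 ^ (k + 3)) pole_sum) / ln (2 ^ (k + 3)))"
    using assms
  proof eventually_elim
    case (elim k)
    let ?r = "2 ^ (k + 3) :: real"
    have rad: "radius k > 0" "?r / radius k = 2"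
      by (simp_all add: radius_def power_add)
    have ln_rad: "ln (radius k) = real (k + 2) * ln 2"
      unfolding radius_def by (rule ln_realpow)
    have ln2: "ln (2::real) > 0" by simp
    have "real (mult k) * ln 2 = real (mult k) * ln (?r / radius k)" by (simp only: rad(2))
    also have "\<dots> \<le> (\<Sum>k | radius k \<le> ?r. real (mult k) * ln (?r / radius k))"
    proof (rule member_le_sum)
      show "k \<in> {k. radius k \<le> ?r}" by (simp add: radius_def power_add)
      fix j assume "j \<in> {k. radius k \<le> ?r} - {k}"
      then have "1 \<le> ?r / radius j" by (simp add: radius_def)
      then show "0 \<le> real (mult j) * ln (?r / radius j)" by simp
    qed (rule finite_poles_in_disc)
    also have "\<dots> = integrated_pole_count ?r pole_sum"
      by (rule integrated_pole_count_pole_sum[symmetric]) simp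
    also have "\<dots> \<le> nevanlinna_char ?r pole_sum"
      using proximity_nonneg by (simp add: nevanlinna_char_def)
    finally have T: "real (mult k) * ln 2 \<le> nevanlinna_char ?r pole_sum" .
    have "s * (real (k + 2) * ln 2) + ln (ln 2) = ln (radius k powr s * ln 2)"
      unfolding ln_rad[symmetric] using rad ln2 by (simp add: ln_mult ln_powr)
    also have "\<dots> \<le> ln (real (mult k) * ln 2)"
      using elim rad ln2 mult_pos[of k] by (subst ln_le_cancel_iff) auto
    also have "\<dots> \<le> log_plus (real (mult k) * ln 2)" by (simp add: log_plus_def)
    also have "\<dots> \<le> log_plus (nevanlinna_char ?r pole_sum)"
      using T ln2 by (intro log_plus_mono) auto
    finally have "?L k \<le> log_plus (nevanlinna_char ?r pole_sum) / (real (k + 3) * ln 2)"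
      by (intro divide_right_mono) auto
    moreover have "ln ?r = real (k + 3) * ln 2" by (rule ln_realpow)
    ultimately show ?case by (simp only: ereal_less_eq)
  qed
qed

lemma card_poles_in_disc:
  assumes "r \<ge> 1"
  shows "real (card {k. radius k \<le> r}) \<le> 2 * ln r"
proof -
  have "{k. radius k \<le> r} \<subseteq> {..<nat \<lfloor>log 2 r\<rfloor>}"
  proof
    fix k assume "k \<in> {k. radius k \<le> r}"
    then have "2 ^ (k + 2) \<le> r" by (simp add: radius_def)
    then have "2 powr real (k + 2) \<le> r" by (simp only: powr_realpow zero_less_numeral)
    then have "real (k + 2) \<le> log 2 r" using assms by (subst le_log_iff) auto
    then show "k \<in> {..<nat \<lfloor>log 2 r\<rfloor>}" by simp linarith
  qed
  then have "card {k. radius k \<le> r} \<le> card {..<nat \<lfloor>log 2 r\<rfloor>}" by (rule card_mono[rotated]) simp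
  then have "real (card {k. radius k \<le> r}) \<le> real (nat \<lfloor>log 2 r\<rfloor>)" by simp
  also have "\<dots> \<le> log 2 r" using assms by simp
  also have "\<dots> = ln r / ln 2" by (simp add: log_def)
  also have "\<dots> \<le> ln r / (1 / 2)" using assms ln2_ge_two_thirds by (intro divide_left_mono) auto
  finally show ?thesis by simp
qed

text \<open>
  At most \<open>2 * ln r\<close> poles lie in the disc of radius \<open>r\<close>, each with
  multiplicity at most \<open>2 * r powr s\<close>, and the proximity function is at most a constant
  times \<open>r powr s\<close>. The powers of \<open>ln r\<close> do not affect the order.
\<close>

lemma growth_order_pole_sum_le:
  assumes s: "s \<ge> 0" and mult: "\<And>k. real (mult k) \<le> 2 * radius k powr s"
  shows "growth_order pole_sum \<le> ereal s"
proof -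
  define c where "c = 80 * 2 powr s"
  let ?B = "\<lambda>r. s + ln (4 * (ln r)\<^sup>2 + c) / ln r"
  have c: "c \<ge> 1" using s ge_one_powr_ge_zero[of 2 s] by (simp add: c_def)
  have T: "nevanlinna_char r pole_sum \<le> r powr s * (4 * (ln r)\<^sup>2 + c)" if r: "r \<ge> 2" for r
  proof -
    have rpos: "radius k > 0" for k by (simp add: radius_def)
    have lnr: "ln r \<ge> 0" using r by simp
    have "integrated_pole_count r pole_sum = (\<Sum>k | radius k \<le> r. real (mult k) * ln (r / radius k))"
      using r by (intro integrated_pole_count_pole_sum) simp
    also have "\<dots> \<le> real (card {k. radius k \<le> r}) * (2 * r powr s * ln r)"
    proof (rule sum_bounded_above)
      fix k assume "k \<in> {k. radius k \<le> r}"
      then have k: "radius k \<le> r" by simp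
      have "real (mult k) \<le> 2 * r powr s"
        using mult[of k] powr_mono2[OF s _ k] rpos[of k] by simp
      moreover have "ln (r / radius k) \<le> ln r"
      proof -
        have "r / radius k \<le> r / 1" using r radius_ge[of k] by (intro divide_left_mono) auto
        then show ?thesis using r rpos[of k] by (subst ln_le_cancel_iff) auto
      qed
      moreover have "0 \<le> ln (r / radius k)" using k rpos[of k] by simp
      ultimately show "real (mult k) * ln (r / radius k) \<le> 2 * r powr s * ln r"
        by (intro mult_mono) auto
    qed
    also have "\<dots> \<le> (2 * ln r) * (2 * r powr s * ln r)"
      using card_poles_in_disc[of r] r lnr by (intro mult_right_mono) auto
    finally have N: "integrated_pole_count r pole_sum \<le> r powr s * (4 * (ln r)\<^sup>2)"
      by (simp add: power2_eq_square mult_ac)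
    have "proximity_fun r pole_sum \<le> r powr s * c"
    proof (cases "\<exists>k. \<bar>r - radius k\<bar> < 1")
      case True
      then obtain k where k: "\<bar>r - radius k\<bar> < 1" by blast
      have "proximity_fun r pole_sum \<le> 40 * real (mult k)"
        using r k by (intro proximity_pole_sum_le) auto
      also have "\<dots> \<le> 40 * (2 * radius k powr s)" using mult by (intro mult_left_mono) auto
      also have "\<dots> \<le> 40 * (2 * (2 * r) powr s)"
        using k r s rpos[of k] by (intro mult_left_mono powr_mono2) auto
      also have "\<dots> = r powr s * c" using r by (simp add: c_def powr_mult)
      finally show ?thesis .
    next
      case False
      then have "proximity_fun r pole_sum = 0"
        using r by (intro proximity_pole_sum_eq_0) (auto simp: not_less)
      then show ?thesis using c by simp
    qed
    with N show ?thesis by (simp add: nevanlinna_char_def algebra_simps)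
  qed
  have "\<forall>\<^sub>F r in at_top. ereal (log_plus (nevanlinna_char r pole_sum) / ln r) \<le> ereal (?B r)"
    using eventually_ge_at_top[of 2]
  proof eventually_elim
    case (elim r)
    have lnr: "ln r > 0" using elim by simp
    have one: "r powr s * (4 * (ln r)\<^sup>2 + c) \<ge> 1 * 1"
      using elim s c by (intro mult_mono ge_one_powr_ge_zero) (auto intro: add_increasing)
    have pos: "4 * (ln r)\<^sup>2 + c > 0" using c by (intro add_nonneg_pos) auto
    have nonneg: "nevanlinna_char r pole_sum \<ge> 0"
    proof -
      have "integrated_pole_count r pole_sum \<ge> 0"
        using elim by (subst integrated_pole_count_pole_sum)
          (auto intro!: sum_nonneg mult_nonneg_nonneg ln_ge_zero simp: radius_def)
      then show ?thesis using proximity_nonneg[of r pole_sum] by (simp add: nevanlinna_char_def)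
    qed
    have "log_plus (nevanlinna_char r pole_sum) \<le> log_plus (r powr s * (4 * (ln r)\<^sup>2 + c))"
      using nonneg T[OF elim] by (rule log_plus_mono)
    also have "\<dots> = ln (r powr s * (4 * (ln r)\<^sup>2 + c))"
      using one by (simp add: log_plus_def)
    also have "\<dots> = s * ln r + ln (4 * (ln r)\<^sup>2 + c)"
      using elim pos by (simp add: ln_mult ln_powr)
    finally have "log_plus (nevanlinna_char r pole_sum) / ln r \<le> (s * ln r + ln (4 * (ln r)\<^sup>2 + c)) / ln r"
      using lnr by (intro divide_right_mono) auto
    also have "\<dots> = ?B r" using lnr by (simp add: add_divide_distrib)
    finally show ?case by simp
  qed
  then have "growth_order pole_sum \<le> Limsup at_top (\<lambda>r. ereal (?B r))"
    unfolding growth_order_def by (rule Limsup_mono)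
  also have "Limsup at_top (\<lambda>r. ereal (?B r)) = ereal s"
  proof (rule lim_imp_Limsup)
    have "(?B \<longlongrightarrow> s) at_top" using c by real_asymp
    then show "((\<lambda>r. ereal (?B r)) \<longlongrightarrow> ereal s) at_top" by (rule tendsto_ereal)
  qed simp
  finally show ?thesis .
qed

end

section \<open>Realising a prescribed set of directions\<close>

theorem theorem1:
  fixes E :: "real set" and \<rho> :: ereal
  assumes "E \<subseteq> {0..<2*pi}" and "E \<noteq> {}"
    and "compact (cis ` E)"
    and "0 \<le> \<rho>"
  shows "\<exists>f g. transcendental_entire f \<and> lower_growth_order f = \<infinity> \<and>
           transcendental_meromorphic g \<and> growth_order g = \<rho> \<and>
           Julia_limiting_directions f = E \<and> Julia_limiting_directions g = E"
proof -
  obtain v :: "nat \<Rightarrow> complex" where v: "range v \<subseteq> cis ` E"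
    "\<And>x e. x \<in> cis ` E \<Longrightarrow> e > 0 \<Longrightarrow> \<exists>k. dist (v k) x < e"
    using dense_sequence[of "cis ` E"] \<open>E \<noteq> {}\<close> by blast
  \<comment> \<open>The pairing function repeats every direction infinitely often, so that poles of arbitrarily large modulus come close to it.\<close>
  define u where "u = (\<lambda>k. v (fst (prod_decode k)))"
  have range: "range u \<subseteq> cis ` E" using v(1) by (auto simp: u_def)
  have dense: "\<exists>k\<ge>n. dist (u k) x < e" if x: "x \<in> cis ` E" and e: "e > 0" for x e n
  proof -
    obtain i where i: "dist (v i) x < e" using v(2)[OF x e] by blast
    have "n \<le> prod_encode (i, n)" by (rule le_prod_encode_2)
    moreover have "u (prod_encode (i, n)) = v i" by (simp add: u_def)
    ultimately show ?thesis using i by metis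
  qed
  \<comment> \<open>For infinite order the exponents tend to infinity.\<close>
  define s where "s = (\<lambda>k::nat. if \<rho> = \<infinity> then real k else real_of_ereal \<rho>)"
  define mult where "mult = (\<lambda>k::nat. nat \<lceil>(2 ^ (k + 2)) powr s k\<rceil>)"
  interpret direction_sequence u
  proof
    fix k
    have "u k \<in> cis ` E" using range by blast
    then show "norm (u k) = 1" by auto
  qed
  interpret pole_sequence u mult
    by unfold_locales (simp add: mult_def)
  have mult_ge: "real (mult k) \<ge> radius k powr s k" for k
    by (simp add: mult_def radius_def)
  have "growth_order pole_sum = \<rho>"
  proof (cases "\<rho> = \<infinity>")
    case True
    have "ereal t \<le> growth_order pole_sum" for t
    proof (rule growth_order_pole_sum_ge)
      have "\<forall>\<^sub>F k in sequentially. t \<le> real k"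
        using filterlim_real_sequentially by (simp add: filterlim_at_top)
      then show "\<forall>\<^sub>F k in sequentially. radius k powr t \<le> real (mult k)"
      proof eventually_elim
        case (elim k)
        have "radius k powr t \<le> radius k powr s k"
          using elim True radius_ge[of k] by (intro powr_mono) (auto simp: s_def)
        then show ?case using mult_ge[of k] by linarith
      qed
    qed
    then have "growth_order pole_sum = \<infinity>" using ereal_top by blast
    then show ?thesis using True by simp
  next
    case False
    then obtain t where t: "\<rho> = ereal t" "t \<ge> 0" using assms(4) by (cases \<rho>) auto
    have st: "s k = t" for k using t by (simp add: s_def)
    show ?thesis
    proof (rule antisym)
      have "real (mult k) \<le> 2 * radius k powr t" for k
      proof -
        have "1 \<le> radius k powr t" using radius_ge[of k] t by (intro ge_one_powr_ge_zero) auto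
        moreover have "real (mult k) \<le> radius k powr t + 1"
          using powr_ge_zero[of "radius k" t] unfolding mult_def st radius_def[symmetric] by linarith
        ultimately show ?thesis by linarith
      qed
      then show "growth_order pole_sum \<le> \<rho>" unfolding t(1) by (intro growth_order_pole_sum_le t)
      show "\<rho> \<le> growth_order pole_sum" unfolding t(1)
        by (rule growth_order_pole_sum_ge) (use mult_ge st in auto)
    qed
  qed
  moreover have "Julia_limiting_directions strip_sum = E"
    by (rule Julia_limiting_directions_strip_sum[OF assms(1,3) range]) (use dense in blast)
  moreover have "Julia_limiting_directions pole_sum = E"
    by (rule Julia_limiting_directions_pole_sum[OF assms(1,3) range dense])
  ultimately show ?thesis
    using strip_sum_transcendental strip_sum_lower_order pole_sum_transcendental by blast
qed

end
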